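(* Let $G$ be a CSA$^\ast$-group, let $A,B$ be malnormal subgroups of $G$, let $\phi:A\to B$ be an isomorphism, and suppose that the HNN-extension $G^\ast=\langle G,t\mid t^{-1}at=\phi(a),\ a\in A\rangle$ is separated. Then $G^\ast$ is a CSA$^\ast$-group.
   Context: Notation: $H^x=x^{-1}Hx$. A subgroup $H$ of a group $G$ is malnormal if $H\cap H^x=1$ for all $x\in G\setminus H$. A group is a CSA-group if all its maximal abelian subgroups are malnormal. A CSA$^\ast$-group is a CSA-group without elements of order 2. The HNN-extension $G^\ast$ is separated if $A\cap g^{-1}Bg=1$ for all $g\in G$. *)

theory Defs
  imports "HOL-Algebra.Multiplicative_Group"
begin

definition maximal_abelian_subgroup :: "'a set \<Rightarrow> ('a, 'm) monoid_scheme \<Rightarrow> bool" where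
  "maximal_abelian_subgroup M G \<longleftrightarrow>
     subgroup M G \<and> comm_group (G\<lparr>carrier := M\<rparr>) \<and>
     (\<forall>N. subgroup N G \<and> comm_group (G\<lparr>carrier := N\<rparr>) \<and> M \<subseteq> N \<longrightarrow> N = M)"

definition malnormal :: "'a set \<Rightarrow> ('a, 'm) monoid_scheme \<Rightarrow> bool" where
  "malnormal H G \<longleftrightarrow>
     subgroup H G \<and>
     (\<forall>x \<in> carrier G - H. H \<inter> (inv\<^bsub>G\<^esub> x <#\<^bsub>G\<^esub> H #>\<^bsub>G\<^esub> x) = {\<one>\<^bsub>G\<^esub>})"

locale csa_group = group +
  assumes maximal_abelian_malnormal: "maximal_abelian_subgroup M G \<Longrightarrow> malnormal M G"

locale csa_star_group = csa_group +
  assumes no_order_two: "x \<in> carrier G \<Longrightarrow> ord x \<noteq> 2"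

text \<open>
  Groups given by a presentation. The letter \<open>(x, True)\<close> stands for the generator \<open>x\<close> and
  \<open>(x, False)\<close> for its formal inverse; a pair \<open>(l, r)\<close> of words is the relation \<open>l = r\<close>.
\<close>

type_synonym 'x gword = "('x \<times> bool) list"

definition gwords :: "'x set \<Rightarrow> 'x gword set" where
  "gwords S = lists (S \<times> UNIV)"

inductive pres_eq :: "'x set \<Rightarrow> ('x gword \<times> 'x gword) set \<Rightarrow> 'x gword \<Rightarrow> 'x gword \<Rightarrow> bool"
  for S R where
  refl: "w \<in> gwords S \<Longrightarrow> pres_eq S R w w"
| sym: "pres_eq S R v w \<Longrightarrow> pres_eq S R w v"
| trans: "pres_eq S R u v \<Longrightarrow> pres_eq S R v w \<Longrightarrow> pres_eq S R u w"
| cancel: "x \<in> S \<Longrightarrow> u \<in> gwords S \<Longrightarrow> v \<in> gwords S \<Longrightarrow>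
    pres_eq S R (u @ [(x, b), (x, \<not> b)] @ v) (u @ v)"
| relation: "(l, r) \<in> R \<Longrightarrow> l \<in> gwords S \<Longrightarrow> r \<in> gwords S \<Longrightarrow>
    u \<in> gwords S \<Longrightarrow> v \<in> gwords S \<Longrightarrow> pres_eq S R (u @ l @ v) (u @ r @ v)"

definition pres_class :: "'x set \<Rightarrow> ('x gword \<times> 'x gword) set \<Rightarrow> 'x gword \<Rightarrow> 'x gword set" where
  "pres_class S R w = {v. pres_eq S R w v}"

definition presented_group ::
  "'x set \<Rightarrow> ('x gword \<times> 'x gword) set \<Rightarrow> 'x gword set monoid" where
  "presented_group S R =
     \<lparr>carrier = pres_class S R ` gwords S,
      mult = (\<lambda>C D. \<Union>u \<in> C. \<Union>v \<in> D. pres_class S R (u @ v)),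
      one = pres_class S R []\<rparr>"

text \<open>
  The HNN-extension \<open>\<langle>G, t | t\<^sup>-\<^sup>1 a t = \<phi> a, a \<in> A\<rangle>\<close>, with the elements of \<open>G\<close> as generators and
  the multiplication table of \<open>G\<close> as its relations. The second associated subgroup is \<open>\<phi> ` A\<close>.
\<close>

datatype 'a hnn_gen = Base 'a | Stable

definition hnn_generators :: "('a, 'm) monoid_scheme \<Rightarrow> 'a hnn_gen set" where
  "hnn_generators G = insert Stable (Base ` carrier G)"

definition hnn_relations ::
  "('a, 'm) monoid_scheme \<Rightarrow> 'a set \<Rightarrow> ('a \<Rightarrow> 'a) \<Rightarrow> ('a hnn_gen gword \<times> 'a hnn_gen gword) set" where
  "hnn_relations G A \<phi> =
     {([(Base g, True), (Base h, True)], [(Base (g \<otimes>\<^bsub>G\<^esub> h), True)]) | g h.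
        g \<in> carrier G \<and> h \<in> carrier G} \<union>
     {([(Stable, False), (Base a, True), (Stable, True)], [(Base (\<phi> a), True)]) | a. a \<in> A}"

definition hnn_extension ::
  "('a, 'm) monoid_scheme \<Rightarrow> 'a set \<Rightarrow> ('a \<Rightarrow> 'a) \<Rightarrow> 'a hnn_gen gword set monoid" where
  "hnn_extension G A \<phi> = presented_group (hnn_generators G) (hnn_relations G A \<phi>)"

definition hnn_separated :: "('a, 'm) monoid_scheme \<Rightarrow> 'a set \<Rightarrow> 'a set \<Rightarrow> bool" where
  "hnn_separated G A B \<longleftrightarrow>
     (\<forall>g \<in> carrier G. A \<inter> (inv\<^bsub>G\<^esub> g <#\<^bsub>G\<^esub> B #>\<^bsub>G\<^esub> g) = {\<one>\<^bsub>G\<^esub>})"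

end

theory Submission
  imports Defs "HOL-Library.Sublist"
begin

text \<open>
  The HNN-extension acts on its Bass--Serre tree, whose vertices are the cosets of \<open>G\<close> and whose edge
  stabilizers are the conjugates of \<open>A\<close>. The stabilizers of the edges at the vertex \<open>G\<close> are the
  conjugates of \<open>A\<close> and of \<open>B\<close> in \<open>G\<close>; malnormality makes two distinct ones of the same kind meet
  trivially, and separation does so for two of different kinds. Hence an element that fixes two
  vertices at distance at least \<open>2\<close> is trivial (\<open>no_two_fixed_neighbours\<close>). This one property gives
  the theorem for every action on a tree without inversions whose vertex stabilizers are
  CSA\<open>\<^sup>*\<close>-groups (\<open>csa_star_group_if_stabilizers\<close>).

  To see this, read CSA as a condition on commuting elements (\<open>csa_groupI\<close> and the lemmas before it):
  elements that commute with some \<open>m \<noteq> \<one>\<close> commute with each other, and \<open>x\<close> commutes with \<open>m\<close> as soon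
  as \<open>m\<close> commutes with its conjugate by \<open>x\<close>. If \<open>m\<close> fixes a vertex, its fixed points form one vertex or
  one edge, which every element concerned maps to itself and, since there are no inversions, fixes
  pointwise; so everything takes place in a vertex stabilizer. If \<open>m\<close> fixes no vertex, it
  translates a line, its axis (\<open>translation_axis\<close>), and no other line (\<open>axis_unique\<close>). Elements that
  commute with \<open>m\<close> translate this axis as well, and since an element is determined by what it does
  to a line, they commute. If \<open>m\<close> commutes with its conjugate by \<open>x\<close>, then \<open>x\<close> maps the axis to itself.
  It cannot reverse the axis, because its square would then be trivial, and an involution fixes a vertex
  (\<open>involution_fixes_vertex\<close>), whose stabilizer has no involutions. So the conjugate of \<open>m\<close> by \<open>x\<close>
  translates the axis exactly as \<open>m\<close> does, and is equal to \<open>m\<close>.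

  The tree itself comes from normal forms. Following van der Waerden, the letters of a word act on
  normal forms \<open>r\<^sub>1 t\<^sup>\<plusminus> r\<^sub>2 t\<^sup>\<plusminus> \<dots> r\<^sub>n t\<^sup>\<plusminus> k\<close>, where the \<open>r\<^sub>i\<close> are coset representatives of \<open>A\<close> or \<open>B\<close> and \<open>k\<close> is
  in \<open>G\<close>; the defining relations hold for this action (\<open>mult_word_cong\<close>), so an element has a unique normal form.
  Leaving out \<open>k\<close> gives a description of the cosets of \<open>G\<close>, and deleting the last syllable \<open>r\<^sub>n t\<^sup>\<plusminus>\<close> leads from
  a vertex to its parent: the vertices form a tree of words. Left multiplication preserves
  adjacency, because the neighbours of \<open>hG\<close> are the cosets \<open>h r t\<^sup>\<plusminus> G\<close>, hence it preserves
  the distance (\<open>act_isometry\<close>). There are no inversions, because an element moving a vertex to a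
  neighbour has exponent sum \<open>\<plusminus>1\<close> in \<open>t\<close>, whereas its square would fix the vertex and have
  exponent sum \<open>0\<close>.
\<close>

section \<open>CSA-groups and commuting elements\<close>

lemma (in group) commutes_inv:
  assumes "x \<in> carrier G" "y \<in> carrier G" "x \<otimes> y = y \<otimes> x"
  shows "inv x \<otimes> y = y \<otimes> inv x"
  using assms by (metis inv_closed inv_solve_left inv_solve_right m_assoc m_closed)

lemma (in group) commutes_mult:
  assumes "x \<in> carrier G" "y \<in> carrier G" "z \<in> carrier G" "x \<otimes> z = z \<otimes> x" "y \<otimes> z = z \<otimes> y"
  shows "x \<otimes> y \<otimes> z = z \<otimes> (x \<otimes> y)"
  using assms by (metis m_assoc)

text \<open>
  Zorn's lemma is applied to sets of pairwise commuting elements instead of abelian subgroups. A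
  maximal such set contains every element that commutes with all of it, and is therefore closed
  under the group operations.
\<close>
lemma (in group) commuting_set_in_maximal_abelian_subgroup:
  assumes T: "T \<subseteq> carrier G" and comm: "\<And>a b. a \<in> T \<Longrightarrow> b \<in> T \<Longrightarrow> a \<otimes> b = b \<otimes> a"
  obtains M where "maximal_abelian_subgroup M G" "T \<subseteq> M"
proof -
  define F where
    "F = {U. T \<subseteq> U \<and> U \<subseteq> carrier G \<and> (\<forall>a\<in>U. \<forall>b\<in>U. a \<otimes> b = b \<otimes> a)}"
  have "\<exists>M\<in>F. \<forall>U\<in>F. M \<subseteq> U \<longrightarrow> U = M"
  proof (rule subset_Zorn_nonempty)
    show "F \<noteq> {}" using assms unfolding F_def by blast
  next
    fix \<C> assume ne: "\<C> \<noteq> {}" and ch: "subset.chain F \<C>"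
    have sub: "\<C> \<subseteq> F" and tot: "\<And>U V. U \<in> \<C> \<Longrightarrow> V \<in> \<C> \<Longrightarrow> U \<subseteq> V \<or> V \<subseteq> U"
      using ch unfolding subset.chain_def by auto
    have "a \<otimes> b = b \<otimes> a" if "U \<in> \<C>" "V \<in> \<C>" "a \<in> U" "b \<in> V" for a b U V
    proof -
      have "a \<in> U \<and> b \<in> U \<or> a \<in> V \<and> b \<in> V" using tot that by blast
      then show ?thesis using sub that unfolding F_def by blast
    qed
    moreover have "T \<subseteq> U \<and> U \<subseteq> carrier G" if "U \<in> \<C>" for U
      using sub that unfolding F_def by blast
    moreover obtain U where "U \<in> \<C>" using ne by blast
    ultimately show "\<Union>\<C> \<in> F" unfolding F_def by (intro CollectI conjI ballI) (blast+)
  qed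
  then obtain M where M: "M \<in> F" and max: "\<And>U. U \<in> F \<Longrightarrow> M \<subseteq> U \<Longrightarrow> U = M"
    by blast
  have TM: "T \<subseteq> M" and MG: "M \<subseteq> carrier G"
    and Mcomm: "\<And>a b. a \<in> M \<Longrightarrow> b \<in> M \<Longrightarrow> a \<otimes> b = b \<otimes> a"
    using M unfolding F_def by auto
  have centr: "c \<in> M" if c: "c \<in> carrier G" "\<And>a. a \<in> M \<Longrightarrow> c \<otimes> a = a \<otimes> c" for c
  proof -
    \<comment> \<open>A maximal set of commuting elements is its own centralizer.\<close>
    have "insert c M \<in> F" using c TM MG Mcomm unfolding F_def by auto
    then show ?thesis using max by blast
  qed
  have sub: "subgroup M G"
  proof (rule subgroupI)
    show "M \<subseteq> carrier G" by (rule MG)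
    have "\<one> \<in> M" using MG by (intro centr) (auto simp: subset_iff)
    then show "M \<noteq> {}" by blast
    show "inv a \<in> M" if "a \<in> M" for a
      using that MG Mcomm by (intro centr) (auto intro!: commutes_inv)
    show "a \<otimes> b \<in> M" if "a \<in> M" "b \<in> M" for a b
      using that MG Mcomm by (intro centr) (auto intro!: commutes_mult simp: subset_iff)
  qed
  have "comm_group (G\<lparr>carrier := M\<rparr>)"
    using subgroup.subgroup_is_group[OF sub] Mcomm
    by (intro group.group_comm_groupI) (auto simp: is_group)
  moreover have "N = M" if "subgroup N G" "comm_group (G\<lparr>carrier := N\<rparr>)" "M \<subseteq> N" for N
  proof (rule max[OF _ that(3)])
    show "N \<in> F" unfolding F_def
      using TM that subgroup.subset[OF that(1)]
        comm_monoid.m_comm[OF comm_group.axioms(1)[OF that(2)]] by auto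
  qed
  ultimately have "maximal_abelian_subgroup M G"
    using sub unfolding maximal_abelian_subgroup_def by blast
  then show thesis using TM that by blast
qed

text \<open>
  Conjugacy is expressed here by the equation \<open>h' x = x h\<close>, so that
  no computation with inverses is needed to use it.
\<close>
lemma malnormal_conjD:
  assumes "malnormal H G" "x \<in> carrier G" "h \<in> H" "h' \<in> H" "h \<noteq> \<one>\<^bsub>G\<^esub>" "group G"
    and "h' \<otimes>\<^bsub>G\<^esub> x = x \<otimes>\<^bsub>G\<^esub> h"
  shows "x \<in> H"
proof (rule ccontr)
  interpret group G by fact
  assume "x \<notin> H"
  have H: "h \<in> carrier G" "h' \<in> carrier G" using assms(1,3,4) 
    unfolding malnormal_def by (auto dest: subgroup.mem_carrier)
  have "h = inv\<^bsub>G\<^esub> x \<otimes>\<^bsub>G\<^esub> h' \<otimes>\<^bsub>G\<^esub> x"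
    using assms(2,7) H by (simp add: m_assoc inv_solve_left)
  then have "h \<in> inv\<^bsub>G\<^esub> x <#\<^bsub>G\<^esub> H #>\<^bsub>G\<^esub> x"
    using assms(4) unfolding l_coset_def r_coset_def by auto
  then show False using assms(1-5) \<open>x \<notin> H\<close> unfolding malnormal_def by blast
qed

context csa_group
begin

text \<open>
  A maximal abelian subgroup \<open>M\<close> that contains \<open>m\<close> and \<open>y\<close> also contains \<open>z\<close>: it is malnormal,
  and \<open>m\<close> lies in \<open>M\<close> and in its conjugate by \<open>z\<close>.
\<close>
lemma centralizer_abelian:
  assumes "m \<in> carrier G" "y \<in> carrier G" "z \<in> carrier G" "m \<noteq> \<one>"
    and "m \<otimes> y = y \<otimes> m" "m \<otimes> z = z \<otimes> m"
  shows "y \<otimes> z = z \<otimes> y"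
proof -
  obtain M where M: "maximal_abelian_subgroup M G" "{m, y} \<subseteq> M"
    by (rule commuting_set_in_maximal_abelian_subgroup[of "{m, y}"]) (use assms in auto)
  with M(2) have "z \<in> M"
    using assms(4,6)
    by (intro malnormal_conjD[OF maximal_abelian_malnormal[OF M(1)] assms(3) _ _ _ is_group, of m m])
      auto
  then show ?thesis
    using M comm_monoid.m_comm[OF comm_group.axioms(1), of "G\<lparr>carrier := M\<rparr>"]
    unfolding maximal_abelian_subgroup_def by auto
qed

text \<open>
  A maximal abelian subgroup that contains \<open>m\<close> and its conjugate \<open>m'\<close> meets its own conjugate
  by \<open>x\<close> in \<open>m'\<close>, so it contains \<open>x\<close>.
\<close>
lemma commutes_with_conjugate:
  assumes "m \<in> carrier G" "m' \<in> carrier G" "x \<in> carrier G" "m \<noteq> \<one>"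
    and "m \<otimes> x = x \<otimes> m'" "m \<otimes> m' = m' \<otimes> m"
  shows "m \<otimes> x = x \<otimes> m"
proof -
  have "m' \<noteq> \<one>"
  proof
    assume "m' = \<one>"
    then have "m \<otimes> x = \<one> \<otimes> x" using assms(3,5) by simp
    then show False using right_cancel[OF assms(3,1) one_closed] assms(4) by simp
  qed
  obtain M where M: "maximal_abelian_subgroup M G" "{m, m'} \<subseteq> M"
    by (rule commuting_set_in_maximal_abelian_subgroup[of "{m, m'}"]) (use assms in auto)
  with M(2) have "x \<in> M"
    using assms(5) \<open>m' \<noteq> \<one>\<close>
    by (intro malnormal_conjD[OF maximal_abelian_malnormal[OF M(1)] assms(3) _ _ _ is_group, of m' m])
      auto
  then show ?thesis
    using M comm_monoid.m_comm[OF comm_group.axioms(1), of "G\<lparr>carrier := M\<rparr>"]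
    unfolding maximal_abelian_subgroup_def by auto
qed

end

text \<open>
  The two properties just derived characterize CSA-groups. Suppose that a maximal abelian subgroup
  \<open>M\<close> contains \<open>h \<noteq> \<one>\<close> and its conjugate \<open>h'\<close>. They commute, so the conjugating element \<open>x\<close> commutes with
  \<open>h'\<close>; as the centralizer of \<open>h'\<close> is abelian, \<open>x\<close> commutes with all of \<open>M\<close>, and maximality puts
  \<open>x\<close> into \<open>M\<close>.
\<close>
lemma (in group) csa_groupI:
  assumes abelian: "\<And>m y z. \<lbrakk>m \<in> carrier G; y \<in> carrier G; z \<in> carrier G; m \<noteq> \<one>;
      m \<otimes> y = y \<otimes> m; m \<otimes> z = z \<otimes> m\<rbrakk> \<Longrightarrow> y \<otimes> z = z \<otimes> y"
    and conj: "\<And>m m' x. \<lbrakk>m \<in> carrier G; m' \<in> carrier G; x \<in> carrier G; m \<noteq> \<one>;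
      m \<otimes> x = x \<otimes> m'; m \<otimes> m' = m' \<otimes> m\<rbrakk> \<Longrightarrow> m \<otimes> x = x \<otimes> m"
  shows "csa_group G"
proof
  fix M assume M: "maximal_abelian_subgroup M G"
  then have sub: "subgroup M G"
    and comm: "\<And>a b. a \<in> M \<Longrightarrow> b \<in> M \<Longrightarrow> a \<otimes> b = b \<otimes> a"
    and max: "\<And>N. subgroup N G \<Longrightarrow> comm_group (G\<lparr>carrier := N\<rparr>) \<Longrightarrow> M \<subseteq> N \<Longrightarrow> N = M"
    unfolding maximal_abelian_subgroup_def
    using comm_monoid.m_comm[OF comm_group.axioms(1), of "G\<lparr>carrier := M\<rparr>"] by auto
  note in_G = subgroup.mem_carrier[OF sub]
  have "h = \<one>" if x: "x \<in> carrier G" "x \<notin> M" and h: "h \<in> M" "h' \<in> M" "h = inv x \<otimes> h' \<otimes> x"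
    for x h h'
  proof (rule ccontr)
    assume "h \<noteq> \<one>"
    then have h1: "h' \<noteq> \<one>" using h x by auto
    have "h' \<otimes> x = x \<otimes> h"
      using h x in_G by (simp add: m_assoc[symmetric])
    then have hx: "h' \<otimes> x = x \<otimes> h'" 
      using conj[of h' h x] h x in_G h1 comm by auto
    have "x \<otimes> a = a \<otimes> x" if "a \<in> M" for a
      using abelian[of h' x a] hx h1 comm that h x in_G by auto
    then obtain N where "maximal_abelian_subgroup N G" "insert x M \<subseteq> N"
      by (rule_tac commuting_set_in_maximal_abelian_subgroup[of "insert x M"])
        (use comm x(1) in_G in auto)
    then show False
      using max[of N] x unfolding maximal_abelian_subgroup_def by auto
  qed
  note key = this
  show "malnormal M G"
    unfolding malnormal_def
  proof (intro conjI ballI sub)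
    fix x assume x: "x \<in> carrier G - M"
    have "h = \<one>" if "h \<in> M" "h \<in> inv x <# M #> x" for h
    proof -
      from that(2) obtain h' where "h' \<in> M" "h = inv x \<otimes> h' \<otimes> x"
        unfolding l_coset_def r_coset_def by auto
      then show ?thesis using key x that(1) by blast
    qed
    moreover have "inv x \<otimes> \<one> \<otimes> x \<in> inv x <# M #> x"
      using subgroup.one_closed[OF sub] unfolding l_coset_def r_coset_def by blast
    moreover have "inv x \<otimes> \<one> \<otimes> x = \<one>" using x by simp
    ultimately have "\<And>h. h \<in> M \<Longrightarrow> h \<in> inv x <# M #> x \<Longrightarrow> h = \<one>" "\<one> \<in> inv x <# M #> x"
      by (blast, simp only:)
    then show "M \<inter> (inv x <# M #> x) = {\<one>}"
      using subgroup.one_closed[OF sub] by blast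
  qed
qed

lemma (in group) ord_2_iff:
  assumes "x \<in> carrier G"
  shows "ord x = 2 \<longleftrightarrow> x \<noteq> \<one> \<and> x \<otimes> x = \<one>"
proof -
  have "x \<otimes> x = \<one> \<longleftrightarrow> ord x dvd 2"
    using pow_eq_id[OF assms, of 2] assms by (simp add: numeral_2_eq_2)
  moreover have "(ord x dvd 2) = (ord x = 1 \<or> ord x = 2)"
    using dvd_imp_le[of "ord x" 2] by (auto simp: le_Suc_eq numeral_2_eq_2)
  ultimately show ?thesis using ord_eq_1[OF assms] by auto
qed

lemma csa_star_group_iso:
  assumes "csa_star_group G" "group K" "f \<in> iso G K"
  shows "csa_star_group K"
proof -
  interpret G: csa_star_group G by fact
  interpret K: group K by fact
  interpret hom: group_hom G K f
    using assms(3) by unfold_locales (auto simp: iso_def)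
  have inj: "inj_on f (carrier G)" and surj: "f ` carrier G = carrier K"
    using assms(3) by (auto simp: iso_def bij_betw_def)
  have eq: "f a = f b \<longleftrightarrow> a = b" if "a \<in> carrier G" "b \<in> carrier G" for a b
    using inj that by (auto dest: inj_onD)
  have lift: "\<exists>a\<in>carrier G. f a = x" if "x \<in> carrier K" for x
    using surj that by (metis imageE)
  have "csa_group K"
  proof (rule K.csa_groupI)
    fix m y z assume "m \<in> carrier K" "y \<in> carrier K" "z \<in> carrier K"
    then obtain m0 y0 z0 where *: "m0 \<in> carrier G" "y0 \<in> carrier G" "z0 \<in> carrier G"
      "m = f m0" "y = f y0" "z = f z0" using lift by metis
    assume "m \<noteq> \<one>\<^bsub>K\<^esub>" "m \<otimes>\<^bsub>K\<^esub> y = y \<otimes>\<^bsub>K\<^esub> m" "m \<otimes>\<^bsub>K\<^esub> z = z \<otimes>\<^bsub>K\<^esub> m"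
    then show "y \<otimes>\<^bsub>K\<^esub> z = z \<otimes>\<^bsub>K\<^esub> y"
      using * G.centralizer_abelian[of m0 y0 z0] eq[of m0 "\<one>\<^bsub>G\<^esub>"]
      by (auto simp: eq simp flip: hom.hom_mult)
  next
    fix m m' x assume "m \<in> carrier K" "m' \<in> carrier K" "x \<in> carrier K"
    then obtain m0 m1 x0 where *: "m0 \<in> carrier G" "m1 \<in> carrier G" "x0 \<in> carrier G"
      "m = f m0" "m' = f m1" "x = f x0" using lift by metis
    assume "m \<noteq> \<one>\<^bsub>K\<^esub>" "m \<otimes>\<^bsub>K\<^esub> x = x \<otimes>\<^bsub>K\<^esub> m'" "m \<otimes>\<^bsub>K\<^esub> m' = m' \<otimes>\<^bsub>K\<^esub> m"
    then show "m \<otimes>\<^bsub>K\<^esub> x = x \<otimes>\<^bsub>K\<^esub> m"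
      using * G.commutes_with_conjugate[of m0 m1 x0] eq[of m0 "\<one>\<^bsub>G\<^esub>"]
      by (auto simp: eq simp flip: hom.hom_mult)
  qed
  moreover have "K.ord x \<noteq> 2" if x: "x \<in> carrier K" for x
  proof -
    obtain x0 where *: "x0 \<in> carrier G" "x = f x0" using lift[OF x] by blast
    have "x \<otimes>\<^bsub>K\<^esub> x = \<one>\<^bsub>K\<^esub> \<longleftrightarrow> x0 \<otimes>\<^bsub>G\<^esub> x0 = \<one>\<^bsub>G\<^esub>" "x = \<one>\<^bsub>K\<^esub> \<longleftrightarrow> x0 = \<one>\<^bsub>G\<^esub>"
      using * eq[of x0 "\<one>\<^bsub>G\<^esub>"] eq[of "x0 \<otimes>\<^bsub>G\<^esub> x0" "\<one>\<^bsub>G\<^esub>"] by auto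
    then show ?thesis
      using *(1) x K.ord_2_iff[of x] G.ord_2_iff[of x0] G.no_order_two[of x0] by simp
  qed
  ultimately show ?thesis
    by (simp add: csa_star_group_def csa_star_group_axioms_def)
qed

section \<open>Trees as metric spaces\<close>

text \<open>
  The vertex set of a tree with its path metric. The four-point condition is \<open>0\<close>-hyperbolicity, and
  \<open>step_towards\<close> makes \<open>d\<close> the path metric of a connected graph. Together they still admit a triangle
  with sides of length \<open>1\<close>; it is excluded by \<open>even_perimeter\<close>.
\<close>
locale tree_metric =
  fixes V :: "'v set" and d :: "'v \<Rightarrow> 'v \<Rightarrow> int"
  assumes dist_eq_0: "x \<in> V \<Longrightarrow> y \<in> V \<Longrightarrow> d x y = 0 \<longleftrightarrow> x = y"
    and dist_sym: "x \<in> V \<Longrightarrow> y \<in> V \<Longrightarrow> d x y = d y x"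
    and four_point: "x \<in> V \<Longrightarrow> y \<in> V \<Longrightarrow> z \<in> V \<Longrightarrow> w \<in> V \<Longrightarrow>
      d x y + d z w \<le> max (d x z + d y w) (d x w + d y z)"
    and even_perimeter: "x \<in> V \<Longrightarrow> y \<in> V \<Longrightarrow> z \<in> V \<Longrightarrow> even (d x y + d y z + d x z)"
    and step_towards: "x \<in> V \<Longrightarrow> y \<in> V \<Longrightarrow> x \<noteq> y \<Longrightarrow> \<exists>p\<in>V. d x p = 1 \<and> d p y = d x y - 1"
begin

lemma triangle:
  assumes "x \<in> V" "y \<in> V" "z \<in> V"
  shows "d x z \<le> d x y + d y z"
  using four_point[of x z y y] dist_eq_0[of y y] dist_sym[of z y] assms by auto

lemma dist_nonneg:
  assumes "x \<in> V" "y \<in> V"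
  shows "0 \<le> d x y"
  using triangle[of x y x] dist_eq_0[of x x] dist_sym[of x y] assms by auto

text \<open>
  Geodesics with the same ends coincide: for \<open>d x p = d x q\<close> the points \<open>p\<close> and \<open>q\<close> are equal.
\<close>
lemma dist_between:
  assumes V: "x \<in> V" "y \<in> V" "p \<in> V" "q \<in> V"
    and "d x p + d p y = d x y" "d x q + d q y = d x y"
  shows "d p q = \<bar>d x p - d x q\<bar>"
  using four_point[of p q x y] triangle[of x p q] triangle[of x q p]
    dist_sym[of x p] dist_sym[of x q] dist_sym[of p q] assms
  by (auto simp: max_def abs_if split: if_splits)

lemma geodesic_point:
  assumes V: "x \<in> V" "y \<in> V" and "0 \<le> i" "i \<le> d x y"
  obtains p where "p \<in> V" "d x p = i" "d p y = d x y - i"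
proof -
  have "int n \<le> d x y \<Longrightarrow> \<exists>p\<in>V. d x p = int n \<and> d p y = d x y - int n" for n
  proof (induction n)
    case 0
    then show ?case using V dist_eq_0[of x x] by auto
  next
    case (Suc n)
    then obtain p where p: "p \<in> V" "d x p = int n" "d p y = d x y - int n" by auto
    then have "p \<noteq> y" using Suc.prems dist_eq_0[of y y] V by auto
    then obtain q where q: "q \<in> V" "d p q = 1" "d q y = d p y - 1"
      using step_towards[of p y] p V by blast
    have "d x q = int (Suc n)"
      using triangle[of x p q] triangle[of x q y] p q V by auto
    then show ?case using p q by auto
  qed
  from this[of "nat i"] show thesis using assms(3,4) that by auto
qed

text \<open>
  In a tree, geodesics that overlap in a segment of positive length combine to a geodesic. The
  four-point condition shows it, because the alternative in its maximum is too small.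
\<close>
lemma geodesics_concatenate:
  assumes "x \<in> V" "y \<in> V" "z \<in> V" "w \<in> V"
    and "d x z = d x y + d y z" "d y w = d y z + d z w" "0 < d y z"
  shows "d x w = d x y + d y z + d z w"
  using four_point[of x z y w] triangle[of x z w] dist_sym[of z y] assms
  by (auto simp: max_def split: if_splits)

text \<open>
  Equal steps along a sequence of points add up to geodesics as soon as any two consecutive steps do.
\<close>
lemma dist_equally_spaced:
  assumes V: "\<And>i. p i \<in> V" and "0 < k"
    and d1: "\<And>i. d (p i) (p (i + 1)) = k" and d2: "\<And>i. d (p i) (p (i + 2)) = 2 * k"
  shows "d (p i) (p j) = k * \<bar>i - j\<bar>"
proof -
  have *: "d (p i) (p (i + int n)) = k * int n" for i n
  proof (induction n rule: less_induct)
    case (less n)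
    consider "n = 0" | "n = 1" | m where "n = Suc (Suc m)"
      by (metis One_nat_def not0_implies_Suc)
    then show ?case
    proof cases
      case 1
      then show ?thesis using dist_eq_0[of "p i" "p i"] V by auto
    next
      case 2
      then show ?thesis using d1 by auto
    next
      case 3
      have "d (p i) (p (i + int m)) = k * int m" "d (p i) (p (i + int m + 1)) = k * int m + k"
        using less.IH[of m] less.IH[of "Suc m"] 3 by (auto simp: algebra_simps)
      then have "d (p i) (p (i + int m + 2)) = k * int m + k + k"
        using geodesics_concatenate[of "p i" "p (i + int m)" "p (i + int m + 1)" "p (i + int m + 2)"]
          d1[of "i + int m"] d1[of "i + int m + 1"] d2[of "i + int m"] V \<open>0 < k\<close> by (auto simp: add.assoc)
      then show ?thesis using 3 by (auto simp: algebra_simps)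
    qed
  qed
  show ?thesis
  proof (cases "i \<le> j")
    case True
    then show ?thesis using *[of i "nat (j - i)"] by (simp add: abs_if)
  next
    case False
    then show ?thesis using *[of j "nat (i - j)"] V dist_sym by (simp add: abs_if)
  qed
qed

definition line :: "(int \<Rightarrow> 'v) \<Rightarrow> bool" where
  "line L \<longleftrightarrow> range L \<subseteq> V \<and> (\<forall>i j. d (L i) (L j) = \<bar>i - j\<bar>)"

lemma line_in: "line L \<Longrightarrow> L i \<in> V"
  and line_dist: "line L \<Longrightarrow> d (L i) (L j) = \<bar>i - j\<bar>"
  unfolding line_def by auto

lemma line_reverse: "line L \<Longrightarrow> line (\<lambda>i. L (- i))"
  unfolding line_def by auto

text \<open>
  Two lines at bounded distance from each other are equal up to a shift of the parameter. A
  point \<open>p\<close> of \<open>L'\<close> lies between points \<open>x'\<close> and \<open>y'\<close> of \<open>L'\<close> far away on both sides. The points \<open>x\<close> and \<open>y\<close> of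
  \<open>L\<close> with the same parameters are near \<open>x'\<close> and \<open>y'\<close> but far from \<open>p\<close>, so the four-point condition allows
  \<open>y'\<close> to be replaced by \<open>y\<close>, and then \<open>x'\<close> by \<open>x\<close>: also \<open>p\<close> lies between \<open>x\<close> and \<open>y\<close>, that is, on \<open>L\<close>. The resulting map
  of parameters is an isometry of the integers at bounded distance from the identity, that is, a
  translation.
\<close>
lemma close_lines_eq:
  assumes L: "line L" and L': "line L'" and C: "\<And>i. d (L i) (L' i) \<le> C"
  obtains s where "\<And>i. L' i = L (i + s)"
proof -
  note V [simp] = line_in[OF L] line_in[OF L']
  have C0: "0 \<le> C" using C[of 0] dist_nonneg[of "L 0" "L' 0"] by simp
  have "\<exists>j. L' i = L j" for i
  proof -
    \<comment> \<open>Any \<open>N > \<bar>i\<bar> + C\<close> makes the ends so distant that the four-point condition decides.\<close>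
    define N p x y x' y' where
      N: "N = \<bar>i\<bar> + C + 1" and p: "p = L' i" and x: "x = L (-N)" and y: "y = L N" and
      x': "x' = L' (-N)" and y': "y' = L' N"
    have in_V [simp]: "p \<in> V" "x \<in> V" "y \<in> V" "x' \<in> V" "y' \<in> V"
      by (auto simp: p x y x' y')
    have ds: "d x y = 2 * N" "d x' y' = 2 * N" "d x' p = N + i" "d p y' = N - i"
      using N C0 by (auto simp: line_dist[OF L] line_dist[OF L'] p x y x' y')
    have c: "d x x' \<le> C" "d y y' \<le> C"
      using C by (auto simp: x y x' y')
    have py: "N - i - C \<le> d p y" and px: "N + i - C \<le> d x p"
      using triangle[of p y y'] triangle[of x' x p] ds c dist_sym[of x x'] by auto
    \<comment> \<open>First \<open>p\<close> lies between \<open>x'\<close> and \<open>y\<close>, then between \<open>x\<close> and \<open>y\<close>.\<close>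
    have "N + i + d p y \<le> d x' y"
      using four_point[of x' y' p y] ds c py N C0 dist_sym[of p y'] dist_sym[of y y']
      by (auto simp: max_def split: if_splits)
    then have "d x p + d p y \<le> d x y"
      using four_point[of x' y p x] ds c px N C0 dist_sym[of p x] dist_sym[of y x]
        dist_sym[of p y] dist_sym[of x x']
      by (auto simp: max_def split: if_splits)
    then have b: "d x p + d p y = d x y" using triangle[of x p y] by simp
    define j where "j = d x p - N"
    have "0 \<le> d x p" "0 \<le> d p y" by (auto intro: dist_nonneg)
    then have "d x (L j) = d x p" "d x (L j) + d (L j) y = d x y"
      using b ds by (auto simp: line_dist[OF L] x y j_def)
    then have "d p (L j) = 0" using dist_between[of x y p "L j"] b by simp
    then show ?thesis using dist_eq_0[of p "L j"] p by auto
  qed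
  then obtain j where j: "\<And>i. L' i = L (j i)" by metis
  have iso: "\<bar>j a - j b\<bar> = \<bar>a - b\<bar>" for a b
    using line_dist[OF L', of a b] line_dist[OF L, of "j a" "j b"] j by simp
  have near: "\<bar>a - j a\<bar> \<le> C" for a
    using C[of a] line_dist[OF L, of a "j a"] j by simp
  have "j i = i + j 0" for i
  proof -
    \<comment> \<open>A reversing isometry would move the far point \<open>n\<close> by more than \<open>C\<close>.\<close>
    define n where "n = \<bar>i\<bar> + C + 1"
    then have "j n = n + j 0"
      using iso[of n 0] near[of n] near[of 0] by arith
    then show ?thesis
      using iso[of i 0] iso[of i n] n_def C0 by arith
  qed
  then show thesis using that[of "j 0"] j by metis
qed

end

text \<open>
  This is what makes a map that respects adjacency an isometry, once its inverse respects
  adjacency too.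
\<close>
lemma (in tree_metric) edge_map_contracts:
  assumes f: "\<And>x. x \<in> V \<Longrightarrow> f x \<in> V"
    and edge: "\<And>x y. x \<in> V \<Longrightarrow> y \<in> V \<Longrightarrow> d x y = 1 \<Longrightarrow> d (f x) (f y) \<le> 1"
    and "x \<in> V" "y \<in> V"
  shows "d (f x) (f y) \<le> d x y"
  using assms(3)
proof (induction "nat (d x y)" arbitrary: x)
  case 0
  then show ?case
    using dist_nonneg[of x y] dist_eq_0[of x y] dist_eq_0[of "f x" "f y"] f assms(4) by auto
next
  case (Suc n)
  then have "x \<noteq> y" using dist_eq_0[of x y] assms(4) by auto
  then obtain p where p: "p \<in> V" "d x p = 1" "d p y = d x y - 1"
    using step_towards[of x y] Suc.prems assms(4) by blast
  moreover have "n = nat (d p y)" using Suc.hyps(2) p(3) by simp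
  then have "d (f p) (f y) \<le> d p y" using Suc.hyps(1) p(1) by blast
  ultimately show ?case
    using triangle[of "f x" "f p" "f y"] edge[of x p] f Suc.prems assms(4) by simp
qed

lemma (in tree_metric) isometry_fixes_between:
  assumes f: "\<And>x. x \<in> V \<Longrightarrow> f x \<in> V" "\<And>x y. x \<in> V \<Longrightarrow> y \<in> V \<Longrightarrow> d (f x) (f y) = d x y"
    and V: "x \<in> V" "y \<in> V" "p \<in> V" and fixed: "f x = x" "f y = y"
    and "d x p + d p y = d x y"
  shows "f p = p"
proof -
  have "d x (f p) = d x p" "d (f p) y = d p y"
    using f(2)[of x p] f(2)[of p y] V fixed by auto
  then have "d (f p) p = 0"
    using dist_between[of x y "f p" p] assms by simp
  then show ?thesis using dist_eq_0 f(1) V by blast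
qed

section \<open>Groups acting on trees\<close>

text \<open>
  The last assumption is the geometric form of malnormality and separation: the fixed points of
  a nontrivial element span at most one edge.
\<close>
locale acylindrical_tree_action = group G + tree_metric V d
  for G :: "('g, 'm) monoid_scheme" (structure) and V :: "'v set" and d +
  fixes act :: "'g \<Rightarrow> 'v \<Rightarrow> 'v"
  assumes vertices_nonempty: "V \<noteq> {}"
    and act_closed [simp]: "g \<in> carrier G \<Longrightarrow> x \<in> V \<Longrightarrow> act g x \<in> V"
    and act_one [simp]: "x \<in> V \<Longrightarrow> act \<one> x = x"
    and act_mult: "g \<in> carrier G \<Longrightarrow> h \<in> carrier G \<Longrightarrow> x \<in> V \<Longrightarrow> act (g \<otimes> h) x = act g (act h x)"
    and act_isometry [simp]: "g \<in> carrier G \<Longrightarrow> x \<in> V \<Longrightarrow> y \<in> V \<Longrightarrow> d (act g x) (act g y) = d x y"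
    and no_inversion: "g \<in> carrier G \<Longrightarrow> x \<in> V \<Longrightarrow> d x (act g x) = 1 \<Longrightarrow> act g (act g x) \<noteq> x"
    and fixes_at_most_edge: "g \<in> carrier G \<Longrightarrow> g \<noteq> \<one> \<Longrightarrow> x \<in> V \<Longrightarrow> y \<in> V \<Longrightarrow>
      act g x = x \<Longrightarrow> act g y = y \<Longrightarrow> d x y \<le> 1"
begin

text \<open>
  A line has vertices at distance \<open>2\<close>, so only the identity fixes it pointwise.
\<close>
lemma eq_if_act_eq_on_line:
  assumes "g \<in> carrier G" "h \<in> carrier G" "line L" "\<And>i. act g (L i) = act h (L i)"
  shows "g = h"
proof -
  have V: "L i \<in> V" for i using line_in assms(3) by auto
  have "act (inv h \<otimes> g) (L i) = L i" for i
    using assms V act_mult[of "inv h" h "L i"] by (simp add: act_mult)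
  moreover have "d (L 0) (L 2) = 2" using line_dist[OF assms(3)] by simp
  ultimately have "inv h \<otimes> g = \<one>"
    using fixes_at_most_edge[of "inv h \<otimes> g" "L 0" "L 2"] assms V by force
  then show ?thesis using assms by (metis inv_closed inv_equality inv_inv)
qed

lemma line_act: "line L \<Longrightarrow> g \<in> carrier G \<Longrightarrow> line (\<lambda>i. act g (L i))"
  unfolding line_def by (auto simp: subset_iff)

text \<open>
  The vertices \<open>v\<close>, \<open>y v\<close> and \<open>y (y v)\<close> are all fixed by \<open>m\<close> and so at most \<open>1\<close> apart. If \<open>y\<close> moved \<open>v\<close>
  then, as a tree contains no triangles, \<open>y\<close> would invert the edge from \<open>v\<close> to \<open>y v\<close>.
\<close>
lemma fixes_vertex_if_moves_within_fixed:
  assumes "m \<in> carrier G" "m \<noteq> \<one>" "y \<in> carrier G" "v \<in> V"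
    and "act m v = v" "act m (act y v) = act y v" "act m (act y (act y v)) = act y (act y v)"
  shows "act y v = v"
proof (rule ccontr)
  assume "act y v \<noteq> v"
  then have "d v (act y v) = 1"
    using fixes_at_most_edge[of m v "act y v"] dist_nonneg[of v "act y v"]
      dist_eq_0[of v "act y v"] assms by auto
  then have "d v (act y (act y v)) = 0"
    using even_perimeter[of v "act y v" "act y (act y v)"]
      fixes_at_most_edge[of m v "act y (act y v)"] dist_nonneg[of v "act y (act y v)"] assms
    by (auto simp: le_less)
  then show False
    using no_inversion[of y v] dist_eq_0[of v "act y (act y v)"] \<open>d v (act y v) = 1\<close> assms by auto
qed

lemma commuting_fixes_vertex:
  assumes "m \<in> carrier G" "m \<noteq> \<one>" "y \<in> carrier G" "v \<in> V" "act m v = v" "m \<otimes> y = y \<otimes> m"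
  shows "act y v = v"
proof -
  have "act m (act y x) = act y (act m x)" if "x \<in> V" for x
    using assms that by (metis act_mult)
  then show ?thesis
    using fixes_vertex_if_moves_within_fixed[of m y v] assms by simp
qed

text \<open>
  Being a conjugate of \<open>m\<close>, the element \<open>m'\<close> has as fixed points the preimages under \<open>x\<close> of those of
  \<open>m\<close>. As \<open>m'\<close> commutes with \<open>m\<close>, it fixes all that \<open>m\<close> fixes, so \<open>x\<close> maps fixed points of \<open>m\<close> to fixed
  points of \<open>m\<close>.
\<close>
lemma conjugating_fixes_vertex:
  assumes "m \<in> carrier G" "m' \<in> carrier G" "m \<noteq> \<one>" "x \<in> carrier G" "v \<in> V" "act m v = v"
    and "m \<otimes> x = x \<otimes> m'" "m \<otimes> m' = m' \<otimes> m"
  shows "act x v = v"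
proof -
  have conj: "act m (act x u) = act x (act m' u)" if "u \<in> V" for u
    using assms that by (metis act_mult)
  have fixed: "act m' u = u" if "u \<in> V" "act m u = u" for u
    using commuting_fixes_vertex[of m m' u] assms that by simp
  show ?thesis
    using fixes_vertex_if_moves_within_fixed[of m x v] fixed conj assms by simp
qed

text \<open>
  Choose \<open>v\<close> with \<open>k = d v (m v)\<close> minimal. If the geodesics from \<open>v\<close> to \<open>m v\<close> and from \<open>m v\<close> to \<open>m (m v)\<close> did not
  fit together to a geodesic, they would share an edge at \<open>m v\<close>. So if \<open>s\<close> is the vertex next to \<open>v\<close> on the way
  to \<open>m v\<close>, then \<open>m s\<close> is the vertex \<open>q\<close> next to \<open>m v\<close> on the way back to \<open>v\<close>. For \<open>k \<ge> 2\<close> this means that \<open>s\<close> is moved by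
  \<open>k - 2\<close> only; for \<open>k = 1\<close> it means that \<open>m\<close> inverts an edge.
\<close>
lemma minimally_displaced_vertex:
  assumes m: "m \<in> carrier G" and free: "\<And>v. v \<in> V \<Longrightarrow> act m v \<noteq> v"
  obtains v where "v \<in> V" "0 < d v (act m v)" "d v (act m (act m v)) = 2 * d v (act m v)"
proof -
  obtain v0 where "v0 \<in> V" using vertices_nonempty by blast
  then obtain v where v: "v \<in> V"
    and least: "\<And>u. u \<in> V \<Longrightarrow> nat (d v (act m v)) \<le> nat (d u (act m u))"
    using ex_has_least_nat[of "\<lambda>v. v \<in> V" v0 "\<lambda>v. nat (d v (act m v))"] by blast
  define k where "k = d v (act m v)"
  have min: "k \<le> d u (act m u)" if "u \<in> V" for u
    using least[OF that] dist_nonneg[of u "act m u"] that m by (simp add: k_def)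
  have "0 < k"
    using dist_nonneg[of v "act m v"] dist_eq_0[of v "act m v"] free[of v] v m
    by (auto simp: k_def le_less)
  have k1: "d v (act m v) = k" "d (act m v) (act m (act m v)) = k" using m v by (auto simp: k_def)
  have "d v (act m (act m v)) = 2 * k"
  proof (rule ccontr)
    assume "d v (act m (act m v)) \<noteq> 2 * k"
    moreover have "d v (act m (act m v)) \<le> 2 * k"
      using triangle[of v "act m v" "act m (act m v)"] k1 m v by simp
    \<comment> \<open>By parity the shortfall is at least \<open>2\<close>, that is, one edge from each geodesic.\<close>
    moreover have "even (d v (act m (act m v)))"
      using even_perimeter[of v "act m v" "act m (act m v)"] k1 m v by simp
    ultimately have short: "d v (act m (act m v)) \<le> 2 * k - 2"
      by presburger
    obtain s where s: "s \<in> V" "d v s = 1" "d s (act m v) = k - 1"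
      using geodesic_point[of v "act m v" 1] k1 m v \<open>0 < k\<close> by auto
    obtain q where q: "q \<in> V" "d v q = k - 1" "d q (act m v) = 1"
      using geodesic_point[of v "act m v" "k - 1"] k1 m v \<open>0 < k\<close> by auto
    have ms: "act m s \<in> V" "d (act m v) (act m s) = 1" "d (act m s) (act m (act m v)) = k - 1"
      using s m v by auto
    have "d v (act m s) \<le> k - 1"
      using four_point[of v "act m s" "act m (act m v)" "act m v"] m v s(1) ms k1 short
        dist_sym[of "act m s" "act m v"] dist_sym[of "act m (act m v)" "act m v"]
      by (auto simp: max_def split: if_splits)
    then have "d q (act m s) \<le> 0"
      using four_point[of q "act m s" v "act m v"] m v s(1) q ms k1
        dist_sym[of "act m s" "act m v"] dist_sym[of q v] dist_sym[of "act m s" v]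
      by (auto simp: max_def split: if_splits)
    then have q_eq: "q = act m s"
      using dist_nonneg[of q "act m s"] dist_eq_0[of q "act m s"] q(1) ms(1) by auto
    show False
    proof (cases "k = 1")
      case True
      then have "s = act m v" "q = v"
        using s q v m dist_eq_0[of s "act m v"] dist_eq_0[of v q] by auto
      then show False using no_inversion[of m v] q_eq True k1 m v by auto
    next
      case False
      have "d s q = \<bar>1 - (k - 1)\<bar>"
        using dist_between[of v "act m v" s q] s q v m k1 by auto
      then show False using min[of s] s(1) q_eq False \<open>0 < k\<close> by auto
    qed
  qed
  then show thesis using that v \<open>0 < k\<close> by (simp add: k_def)
qed

text \<open>
  Otherwise the square of \<open>m\<close> would move some vertex, by twice the least displacement of \<open>m\<close>.
\<close>
lemma involution_fixes_vertex:
  assumes "m \<in> carrier G" "m \<otimes> m = \<one>"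
  obtains v where "v \<in> V" "act m v = v"
proof (rule ccontr)
  assume "\<not> thesis"
  then have "\<And>v. v \<in> V \<Longrightarrow> act m v \<noteq> v" using that by blast
  then obtain v where "v \<in> V" "0 < d v (act m v)" "d v (act m (act m v)) = 2 * d v (act m v)"
    using minimally_displaced_vertex assms(1) by blast
  moreover have "act m (act m v) = v" using \<open>v \<in> V\<close> assms act_mult[of m m v] by simp
  ultimately show False using dist_eq_0[of v v] by simp
qed

text \<open>
  The translates by powers of \<open>m\<close> of a geodesic \<open>p\<close> from a minimally displaced vertex \<open>v\<close> to \<open>m v\<close> form the line.
  To compute the distance of two of its points, note that both lie between \<open>m\<^sup>-\<^sup>N v\<close> and \<open>m\<^sup>N v\<close> for large \<open>N\<close>.
\<close>
lemma translation_axis: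
  assumes m: "m \<in> carrier G" and free: "\<And>v. v \<in> V \<Longrightarrow> act m v \<noteq> v"
  obtains L k where "line L" "0 < k" "\<And>i. act m (L i) = L (i + k)"
proof -
  obtain v where v: "v \<in> V" "0 < d v (act m v)" "d v (act m (act m v)) = 2 * d v (act m v)"
    using minimally_displaced_vertex[OF m free] by blast
  define k where "k = d v (act m v)"
  define orb where "orb i = act (m [^] i) v" for i :: int
  have k: "0 < k" using v by (simp add: k_def)
  have orb_V [simp]: "orb i \<in> V" for i using m v by (simp add: orb_def)
  have pow: "act (m [^] (i + j)) x = act (m [^] i) (act (m [^] j) x)" if "x \<in> V" for x and i j :: int
    using that m int_pow_mult[of m i j] by (simp add: act_mult)
  have pow_Suc: "act m (act (m [^] i) x) = act (m [^] (i + 1)) x" if "x \<in> V" for x and i :: int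
    using pow[OF that, of 1 i] m by (simp add: add.commute)
  have orb_dist: "d (orb i) (orb j) = k * \<bar>i - j\<bar>" for i j
  proof (rule dist_equally_spaced)
    show "d (orb i) (orb (i + 1)) = k" for i
      using v m pow[of v i 1] by (simp add: orb_def k_def)
    have "act (m [^] (2::int)) v = act m (act m v)"
      using v m pow[of v 1 1] by simp
    then show "d (orb i) (orb (i + 2)) = 2 * k" for i
      using v m pow[of v i 2] by (simp add: orb_def k_def)
  qed (use k in auto)
  have "\<exists>p\<in>V. d v p = r \<and> d p (act m v) = k - r" if "0 \<le> r" "r \<le> k" for r
    using geodesic_point[of v "act m v" r] that m v by (auto simp: k_def)
  then obtain p where p: "\<And>r. 0 \<le> r \<Longrightarrow> r \<le> k \<Longrightarrow> p r \<in> V \<and> d v (p r) = r \<and> d (p r) (act m v) = k - r"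
    by metis
  \<comment> \<open>The quotient selects the translate of the geodesic, the remainder the position on it.\<close>
  define L where "L i = act (m [^] (i div k)) (p (i mod k))" for i
  have mod_k: "0 \<le> i mod k" "i mod k \<le> k" for i
    using k pos_mod_bound[of k i] by (auto intro: less_imp_le)
  have L_V [simp]: "L i \<in> V" for i
    using p[OF mod_k] m by (simp add: L_def)
  have L_between: "d (orb (i div k)) (L i) = i mod k" "d (L i) (orb (i div k + 1)) = k - i mod k" for i
  proof -
    have "d (orb (i div k)) (L i) = d v (p (i mod k))"
      using p[OF mod_k] m v by (simp add: L_def orb_def)
    moreover have "d (L i) (orb (i div k + 1)) = d (p (i mod k)) (act m v)"
      using p[OF mod_k] m v pow[of v "i div k" 1] by (simp add: L_def orb_def)
    ultimately show "d (orb (i div k)) (L i) = i mod k" "d (L i) (orb (i div k + 1)) = k - i mod k"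
      using p[OF mod_k] by auto
  qed
  have "d (L i) (L j) = \<bar>i - j\<bar>" for i j
  proof -
    define N where "N = \<bar>i div k\<bar> + \<bar>j div k\<bar> + 1"
    define x y where "x = orb (- N)" and "y = orb N"
    have V: "x \<in> V" "y \<in> V" by (auto simp: x_def y_def)
    have xy: "d x y = 2 * (N * k)" by (simp add: x_def y_def orb_dist N_def)
    have pos: "d x (L a) = a + N * k" "d (L a) y = N * k - a" if a: "\<bar>a div k\<bar> < N" for a
    proof -
      have orb_xy: "d x (orb (a div k)) = N * k + k * (a div k)"
        "d (orb (a div k + 1)) y = N * k - k * (a div k) - k"
        using a by (auto simp: x_def y_def orb_dist algebra_simps)
      have "k * (a div k) + a mod k = a" by simp
      then have "d x (L a) \<le> a + N * k" "d (L a) y \<le> N * k - a"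
        using orb_xy L_between[of a] triangle[OF V(1) orb_V L_V, of a "a div k"]
          triangle[OF L_V orb_V V(2), of a "a div k + 1"] by linarith+
      then show "d x (L a) = a + N * k" "d (L a) y = N * k - a"
        using triangle[of x "L a" y] xy V by auto
    qed
    show ?thesis
      using dist_between[of x y "L i" "L j"] pos[of i] pos[of j] xy V by (simp add: N_def)
  qed
  then have "line L" unfolding line_def by auto
  moreover have "act m (L i) = L (i + k)" for i
    using p[OF mod_k] m k by (simp add: L_def pow_Suc)
  ultimately show thesis using that k by blast
qed

lemma translate_iterate:
  assumes m: "m \<in> carrier G" and L: "line L" and tr: "\<And>i. act m (L i) = L (i + k)"
  shows "act (m [^] (n::nat)) (L i) = L (i + int n * k)"
proof (induction n arbitrary: i)
  case 0
  then show ?case using line_in[OF L] by simp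
next
  case (Suc n)
  then show ?case using m line_in[OF L] tr by (simp add: act_mult algebra_simps)
qed

text \<open>
  Applying \<open>m\<close> repeatedly moves a point of \<open>L\<close> and a point of \<open>L'\<close> away at speeds \<open>\<bar>k\<bar>\<close> and \<open>\<bar>k'\<bar>\<close>
  while their distance stays \<open>D\<close>. For \<open>\<bar>k\<bar> > \<bar>k'\<bar>\<close> this fails after more than \<open>2 D\<close> steps.
\<close>
lemma translation_length_le:
  assumes m: "m \<in> carrier G" and L: "line L" "\<And>i. act m (L i) = L (i + k)"
    and L': "line L'" "\<And>i. act m (L' i) = L' (i + k')"
  shows "\<bar>k\<bar> \<le> \<bar>k'\<bar>"
proof (rule ccontr)
  assume "\<not> \<bar>k\<bar> \<le> \<bar>k'\<bar>"
  define D where "D = d (L 0) (L' 0)"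
  \<comment> \<open>After \<open>2 D + 1\<close> steps the gap is more than the two connecting distances can bridge.\<close>
  define n where "n = nat (2 * D + 1)"
  note V [simp] = line_in[OF L(1)] line_in[OF L'(1)]
  have "0 \<le> D" by (auto simp: D_def intro: dist_nonneg)
  have "d (L (int n * k)) (L' (int n * k')) = D"
    using translate_iterate[OF m L, of n 0] translate_iterate[OF m L', of n 0]
      act_isometry[of "m [^] n" "L 0" "L' 0"] m by (simp add: D_def)
  moreover have "d (L 0) (L (int n * k)) = int n * \<bar>k\<bar>" "d (L' 0) (L' (int n * k')) = int n * \<bar>k'\<bar>"
    using line_dist[OF L(1)] line_dist[OF L'(1)] by (auto simp: abs_mult)
  ultimately have "int n * \<bar>k\<bar> \<le> 2 * D + int n * \<bar>k'\<bar>"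
    using triangle[of "L 0" "L' 0" "L (int n * k)"] triangle[of "L' 0" "L' (int n * k')" "L (int n * k)"]
      dist_sym[of "L (int n * k)" "L' (int n * k')"] by (simp add: D_def)
  moreover have "int n * (\<bar>k'\<bar> + 1) \<le> int n * \<bar>k\<bar>"
    using \<open>\<not> \<bar>k\<bar> \<le> \<bar>k'\<bar>\<close> by (intro mult_left_mono) auto
  ultimately show False using \<open>0 \<le> D\<close> by (simp add: n_def algebra_simps)
qed

text \<open>
  As \<open>m\<close> translates both lines by the same amount, the distance of points with equal parameters
  is periodic in the parameter, hence bounded.
\<close>
lemma axis_unique:
  assumes m: "m \<in> carrier G" and "0 < k"
    and L: "line L" "\<And>i. act m (L i) = L (i + k)"
    and L': "line L'" "\<And>i. act m (L' i) = L' (i + k)"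
  obtains s where "\<And>i. L' i = L (i + s)"
proof (rule close_lines_eq[OF L(1) L'(1)])
  note V [simp] = line_in[OF L(1)] line_in[OF L'(1)]
  show "d (L i) (L' i) \<le> d (L 0) (L' 0) + 2 * k" for i
  proof -
    have per: "d (L (i + int n * k)) (L' (i + int n * k)) = d (L i) (L' i)" for n i
      using translate_iterate[OF m L, of n i] translate_iterate[OF m L', of n i]
        act_isometry[of "m [^] n" "L i" "L' i"] m by simp
    define r where "r = i mod k"
    have r: "0 \<le> r" "r < k" using \<open>0 < k\<close> by (auto simp: r_def)
    have "d (L i) (L' i) = d (L r) (L' r)"
    proof (cases "0 \<le> i div k")
      case True
      then show ?thesis
        using per[of r "nat (i div k)"] by (simp add: r_def add.commute)
    next
      case False
      then have "i + int (nat (- (i div k))) * k = r"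
        using minus_div_mult_eq_mod[of i k] by (simp add: r_def)
      then show ?thesis using per[of i "nat (- (i div k))"] by simp
    qed
    also have "\<dots> \<le> d (L 0) (L' 0) + 2 * k"
      using triangle[of "L r" "L 0" "L' r"] triangle[of "L 0" "L' 0" "L' r"] r
        line_dist[OF L(1)] line_dist[OF L'(1)] by simp
    finally show ?thesis .
  qed
qed (use that in blast)

text \<open>
  The image of the axis of \<open>m\<close> under \<open>y\<close> is again translated by \<open>m\<close>.
\<close>
lemma commuting_translates_axis:
  assumes m: "m \<in> carrier G" and y: "y \<in> carrier G" "m \<otimes> y = y \<otimes> m" and k: "0 < k"
    and L: "line L" "\<And>i. act m (L i) = L (i + k)"
  obtains c where "\<And>i. act y (L i) = L (i + c)"
proof -
  have "act m (act y (L i)) = act y (L (i + k))" for i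
    using m y line_in[OF L(1)] L(2) by (metis act_mult)
  then show thesis
    using axis_unique[OF m k L line_act[OF L(1) y(1)]] that by blast
qed

text \<open>
  Both \<open>y\<close> and \<open>z\<close> translate the axis of \<open>m\<close>, so \<open>y z\<close> and \<open>z y\<close> agree on it.
\<close>
lemma commuting_with_translation_commute:
  assumes m: "m \<in> carrier G" and free: "\<And>v. v \<in> V \<Longrightarrow> act m v \<noteq> v"
    and y: "y \<in> carrier G" "m \<otimes> y = y \<otimes> m" and z: "z \<in> carrier G" "m \<otimes> z = z \<otimes> m"
  shows "y \<otimes> z = z \<otimes> y"
proof -
  obtain L k where L: "line L" "0 < k" "\<And>i. act m (L i) = L (i + k)"
    using translation_axis[OF m free] by metis
  obtain b where b: "\<And>i. act y (L i) = L (i + b)"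
    using commuting_translates_axis[OF m y L(2,1,3)] by blast
  obtain c where c: "\<And>i. act z (L i) = L (i + c)"
    using commuting_translates_axis[OF m z L(2,1,3)] by blast
  show ?thesis
    using y z b c line_in[OF L(1)]
    by (intro eq_if_act_eq_on_line[OF _ _ L(1)]) (auto simp: act_mult algebra_simps)
qed

text \<open>
  The image of the axis \<open>L\<close> of \<open>m\<close> under \<open>x\<close> is translated by \<open>m\<close> by the amount \<open>c\<close> by which \<open>m'\<close> translates \<open>L\<close>, and
  so \<open>c = \<plusminus>k\<close>. If \<open>c = k\<close>, then \<open>m\<close> and \<open>m'\<close> agree on \<open>L\<close>. If \<open>c = -k\<close>, then \<open>x\<close> reverses \<open>L\<close>, and its square is
  trivial.
\<close>
lemma conjugator_of_commuting_translations_commutes: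
  assumes m: "m \<in> carrier G" and free: "\<And>v. v \<in> V \<Longrightarrow> act m v \<noteq> v"
    and m': "m' \<in> carrier G" "m \<otimes> m' = m' \<otimes> m"
    and x: "x \<in> carrier G" "m \<otimes> x = x \<otimes> m'"
    and no_invol: "x \<otimes> x = \<one> \<Longrightarrow> x = \<one>"
  shows "m \<otimes> x = x \<otimes> m"
proof -
  obtain L k where L: "line L" "0 < k" "\<And>i. act m (L i) = L (i + k)"
    using translation_axis[OF m free] by metis
  note V [simp] = line_in[OF L(1)]
  obtain c where c: "\<And>i. act m' (L i) = L (i + c)"
    using commuting_translates_axis[OF m m' L(2,1,3)] by blast
  have xL: "line (\<lambda>i. act x (L i))" using line_act L x by blast
  have mx: "act m (act x (L i)) = act x (L (i + c))" for i
    using m m' x c V by (metis act_mult)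
  have "\<bar>k\<bar> = \<bar>c\<bar>"
    using translation_length_le[OF m L(1,3) xL mx] translation_length_le[OF m xL mx L(1,3)] by simp
  then consider "c = k" | "c = - k" by linarith
  then show ?thesis
  proof cases
    case 1
    then have "act m' (L i) = act m (L i)" for i using c L by simp
    then have "m' = m" using eq_if_act_eq_on_line[OF m'(1) m L(1)] by blast
    then show ?thesis using x by simp
  next
    case 2
    have "act m (act x (L (- i))) = act x (L (- (i + k)))" for i
      using mx[of "- i"] 2 by (simp add: algebra_simps)
    then obtain s where s: "\<And>i. act x (L (- i)) = L (i + s)"
      using axis_unique[OF m L(2,1,3) line_reverse[OF xL]] by blast
    \<comment> \<open>So \<open>x\<close> acts on the axis as a reflection.\<close>
    have refl: "act x (L i) = L (s - i)" for i using s[of "- i"] by simp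
    have "x \<otimes> x = \<one>"
      using x refl V by (intro eq_if_act_eq_on_line[OF _ _ L(1)]) (auto simp: act_mult)
    then have "x = \<one>" using no_invol by blast
    then show ?thesis using m by simp
  qed
qed

theorem csa_star_group_if_stabilizers:
  assumes stab: "\<And>v. v \<in> V \<Longrightarrow> csa_star_group (G\<lparr>carrier := {g \<in> carrier G. act g v = v}\<rparr>)"
  shows "csa_star_group G"
proof -
  have no_invol: "x = \<one>" if x: "x \<in> carrier G" "x \<otimes> x = \<one>" for x
  proof -
    obtain v where v: "v \<in> V" "act x v = v" using involution_fixes_vertex x by blast
    interpret S: csa_star_group "G\<lparr>carrier := {g \<in> carrier G. act g v = v}\<rparr>" using stab v by blast
    show ?thesis
      using S.ord_2_iff[of x] S.no_order_two[of x] x v by auto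
  qed
  have "csa_group G"
  proof (rule csa_groupI)
    fix m y z
    assume *: "m \<in> carrier G" "y \<in> carrier G" "z \<in> carrier G" "m \<noteq> \<one>"
      "m \<otimes> y = y \<otimes> m" "m \<otimes> z = z \<otimes> m"
    show "y \<otimes> z = z \<otimes> y"
    proof (cases "\<exists>v\<in>V. act m v = v")
      case True
      then obtain v where v: "v \<in> V" "act m v = v" by blast
      interpret S: csa_star_group "G\<lparr>carrier := {g \<in> carrier G. act g v = v}\<rparr>" using stab v by blast
      have "act y v = v" "act z v = v"
        using commuting_fixes_vertex v * by auto
      then show ?thesis using S.centralizer_abelian[of m y z] v * by auto
    next
      case False
      then show ?thesis using commuting_with_translation_commute[of m y z] * by blast
    qed
  next
    fix m m' x
    assume *: "m \<in> carrier G" "m' \<in> carrier G" "x \<in> carrier G" "m \<noteq> \<one>"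
      "m \<otimes> x = x \<otimes> m'" "m \<otimes> m' = m' \<otimes> m"
    show "m \<otimes> x = x \<otimes> m"
    proof (cases "\<exists>v\<in>V. act m v = v")
      case True
      then obtain v where v: "v \<in> V" "act m v = v" by blast
      interpret S: csa_star_group "G\<lparr>carrier := {g \<in> carrier G. act g v = v}\<rparr>" using stab v by blast
      have "act m' v = v" "act x v = v"
        using commuting_fixes_vertex[of m m' v] conjugating_fixes_vertex[of m m' x v] v * by auto
      then show ?thesis using S.commutes_with_conjugate[of m m' x] v * by auto
    next
      case False
      then show ?thesis
        using conjugator_of_commuting_translations_commutes[of m m' x] no_invol * by blast
    qed
  qed
  moreover have "ord x \<noteq> 2" if "x \<in> carrier G" for x
    using ord_2_iff[OF that] no_invol that by blast
  ultimately show ?thesis by (simp add: csa_star_group_def csa_star_group_axioms_def)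
qed

end

section \<open>Presented groups\<close>

lemma gwords_simps [simp]:
  "[] \<in> gwords S" "x # w \<in> gwords S \<longleftrightarrow> fst x \<in> S \<and> w \<in> gwords S"
  "u @ v \<in> gwords S \<longleftrightarrow> u \<in> gwords S \<and> v \<in> gwords S"
  unfolding gwords_def by (auto simp: mem_Times_iff)

lemma pres_eq_gwords: "pres_eq S R u v \<Longrightarrow> u \<in> gwords S \<and> v \<in> gwords S"
  by (induction rule: pres_eq.induct) auto

lemma pres_eq_append_left:
  "pres_eq S R u v \<Longrightarrow> w \<in> gwords S \<Longrightarrow> pres_eq S R (w @ u) (w @ v)"
proof (induction rule: pres_eq.induct)
  case (cancel x u v b)
  then show ?case using pres_eq.cancel[of x S "w @ u" v R b] by simp
next
  case (relation l r u v)
  then show ?case using pres_eq.relation[of l r R S "w @ u" v] by simp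
qed (auto intro: pres_eq.refl pres_eq.sym pres_eq.trans)

lemma pres_eq_append_right:
  "pres_eq S R u v \<Longrightarrow> w \<in> gwords S \<Longrightarrow> pres_eq S R (u @ w) (v @ w)"
proof (induction rule: pres_eq.induct)
  case (cancel x u v b)
  then show ?case using pres_eq.cancel[of x S u "v @ w" R b] by simp
next
  case (relation l r u v)
  then show ?case using pres_eq.relation[of l r R S u "v @ w"] by simp
qed (auto intro: pres_eq.refl pres_eq.sym pres_eq.trans)

lemma pres_eq_append:
  "pres_eq S R u u' \<Longrightarrow> pres_eq S R v v' \<Longrightarrow> pres_eq S R (u @ v) (u' @ v')"
  by (meson pres_eq.trans pres_eq_append_left pres_eq_append_right pres_eq_gwords)

lemma pres_class_eqI: "pres_eq S R u v \<Longrightarrow> pres_class S R u = pres_class S R v"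
  unfolding pres_class_def by (auto intro: pres_eq.sym pres_eq.trans)

lemma presented_group_simps:
  "carrier (presented_group S R) = pres_class S R ` gwords S"
  "\<one>\<^bsub>presented_group S R\<^esub> = pres_class S R []"
  unfolding presented_group_def by simp_all

lemma pres_class_mult:
  assumes "u \<in> gwords S" "v \<in> gwords S"
  shows "pres_class S R u \<otimes>\<^bsub>presented_group S R\<^esub> pres_class S R v = pres_class S R (u @ v)"
proof -
  have eq: "pres_class S R (u' @ v') = pres_class S R (u @ v)"
    if "u' \<in> pres_class S R u" "v' \<in> pres_class S R v" for u' v'
    using pres_class_eqI[OF pres_eq_append, of S R u u' v v'] that by (simp add: pres_class_def)
  have mem: "u \<in> pres_class S R u" "v \<in> pres_class S R v"
    using assms pres_eq.refl by (auto simp: pres_class_def)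
  have "(\<Union>u' \<in> pres_class S R u. \<Union>v' \<in> pres_class S R v. pres_class S R (u' @ v')) =
      (\<Union>u' \<in> pres_class S R u. \<Union>v' \<in> pres_class S R v. pres_class S R (u @ v))"
    by (intro SUP_cong HOL.refl eq)
  also have "\<dots> = pres_class S R (u @ v)"
    by (metis SUP_const empty_iff mem)
  finally show ?thesis by (simp add: presented_group_def)
qed

definition formal_inverse :: "'x gword \<Rightarrow> 'x gword" where
  "formal_inverse w = rev (map (\<lambda>(x, b). (x, \<not> b)) w)"

lemma pres_eq_formal_inverse:
  "w \<in> gwords S \<Longrightarrow> formal_inverse w \<in> gwords S \<and> pres_eq S R (formal_inverse w @ w) []"
proof (induction w)
  case Nil
  then show ?case by (simp add: formal_inverse_def pres_eq.refl)
next
  case (Cons a w)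
  obtain x b where a: "a = (x, b)" by (cases a)
  have "pres_eq S R (formal_inverse w @ [(x, \<not> b), (x, \<not> \<not> b)] @ w) (formal_inverse w @ w)"
    using Cons a by (intro pres_eq.cancel) auto
  then show ?case
    using Cons a pres_eq.trans by (auto simp: formal_inverse_def)
qed

theorem presented_group_is_group: "group (presented_group S R)"
proof (rule groupI)
  let ?K = "presented_group S R"
  show "x \<otimes>\<^bsub>?K\<^esub> y \<in> carrier ?K" if "x \<in> carrier ?K" "y \<in> carrier ?K" for x y
    using that by (auto simp: presented_group_simps pres_class_mult)
  show "\<one>\<^bsub>?K\<^esub> \<in> carrier ?K" by (simp add: presented_group_simps)
  show "x \<otimes>\<^bsub>?K\<^esub> y \<otimes>\<^bsub>?K\<^esub> z = x \<otimes>\<^bsub>?K\<^esub> (y \<otimes>\<^bsub>?K\<^esub> z)"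
    if "x \<in> carrier ?K" "y \<in> carrier ?K" "z \<in> carrier ?K" for x y z
    using that by (auto simp: presented_group_simps pres_class_mult)
  show "\<one>\<^bsub>?K\<^esub> \<otimes>\<^bsub>?K\<^esub> x = x" if "x \<in> carrier ?K" for x
    using that by (auto simp: presented_group_simps pres_class_mult)
  show "\<exists>y\<in>carrier ?K. y \<otimes>\<^bsub>?K\<^esub> x = \<one>\<^bsub>?K\<^esub>" if x: "x \<in> carrier ?K" for x
  proof -
    obtain w where w: "w \<in> gwords S" "x = pres_class S R w"
      using x by (auto simp: presented_group_simps)
    then show ?thesis
      using pres_eq_formal_inverse[of w S R] pres_class_eqI[of S R "formal_inverse w @ w" "[]"]
      by (auto simp: presented_group_simps pres_class_mult intro!: bexI[of _ "formal_inverse w"])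
  qed
qed

section \<open>Trees of words\<close>

definition common_suffix_length :: "'b list \<Rightarrow> 'b list \<Rightarrow> nat" where
  "common_suffix_length u v = length (longest_common_prefix (rev u) (rev v))"

text \<open>
  The path metric of the tree in which \<open>w\<close> is the parent of \<open>a # w\<close>: two words are joined by
  way of their longest common suffix.
\<close>
definition word_dist :: "'b list \<Rightarrow> 'b list \<Rightarrow> int" where
  "word_dist u v = int (length u) + int (length v) - 2 * int (common_suffix_length u v)"

lemma le_common_suffix_length_iff:
  "n \<le> common_suffix_length u v \<longleftrightarrow>
     n \<le> length u \<and> n \<le> length v \<and> take n (rev u) = take n (rev v)"
proof
  let ?p = "longest_common_prefix (rev u) (rev v)"
  have pre: "prefix ?p (rev u)" "prefix ?p (rev v)"
    by (rule longest_common_prefix_prefix1 longest_common_prefix_prefix2)+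
  assume n: "n \<le> common_suffix_length u v"
  have "take n w = take n ?p" if "prefix ?p w" for w
    using that n by (elim prefixE) (simp add: common_suffix_length_def)
  then have "take n (rev u) = take n ?p" "take n (rev v) = take n ?p"
    using pre by blast+
  then show "n \<le> length u \<and> n \<le> length v \<and> take n (rev u) = take n (rev v)"
    using prefix_length_le[OF pre(1)] prefix_length_le[OF pre(2)] n
    by (simp add: common_suffix_length_def)
next
  assume n: "n \<le> length u \<and> n \<le> length v \<and> take n (rev u) = take n (rev v)"
  then have "prefix (take n (rev u)) (longest_common_prefix (rev u) (rev v))"
    by (metis longest_common_prefix_max_prefix take_is_prefix)
  then show "n \<le> common_suffix_length u v"
    using n prefix_length_le by (fastforce simp: common_suffix_length_def)
qed

lemma common_suffix_length_sym: "common_suffix_length u v = common_suffix_length v u"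
  by (metis le_common_suffix_length_iff order_refl order_antisym)

lemma common_suffix_length_le:
  "common_suffix_length u v \<le> length u" "common_suffix_length u v \<le> length v"
  using le_common_suffix_length_iff by blast+

text \<open>
  This ultrametric inequality is what the four-point condition amounts to for words.
\<close>
lemma common_suffix_length_ultrametric:
  "min (common_suffix_length u v) (common_suffix_length v w) \<le> common_suffix_length u w"
  using le_common_suffix_length_iff[of _ u v] le_common_suffix_length_iff[of _ v w]
    le_common_suffix_length_iff[of _ u w] by (metis min.cobounded1 min.cobounded2)

lemma common_suffix_length_append [simp]: "common_suffix_length u (v @ u) = length u"
  using le_common_suffix_length_iff[of "length u" u "v @ u"] common_suffix_length_le[of u "v @ u"]
  by simp

lemma common_suffix_length_eq_length:
  assumes "common_suffix_length u v = length u"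
  obtains w where "v = w @ u"
proof -
  have "rev u = take (length u) (rev v)"
    using le_common_suffix_length_iff[of "length u" u v] assms by simp
  then have "prefix (rev u) (rev v)" by (metis take_is_prefix)
  then show thesis using that by (auto simp: prefix_def rev_eq_append_conv)
qed

lemma common_suffix_length_tl:
  assumes "common_suffix_length u v < length u"
  shows "common_suffix_length (tl u) v = common_suffix_length u v"
proof -
  obtain a t where u: "u = a # t" using assms by (cases u) auto
  have "n \<le> common_suffix_length t v \<longleftrightarrow> n \<le> common_suffix_length u v" for n
  proof (cases "n \<le> length t")
    case True
    then show ?thesis by (simp add: u le_common_suffix_length_iff)
  next
    case False
    then show ?thesis using assms common_suffix_length_le[of t v] unfolding u by simp
  qed
  then show ?thesis using u by (metis list.sel(3) order_antisym order_refl)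
qed

lemma word_dist_sym: "word_dist u v = word_dist v u"
  by (simp add: word_dist_def common_suffix_length_sym)

lemma word_dist_append [simp]: "word_dist u (v @ u) = int (length v)"
  by (simp add: word_dist_def)

lemma word_dist_Cons [simp]: "word_dist u (a # u) = 1" "word_dist (a # u) u = 1"
  using word_dist_append[of u "[a]"] word_dist_sym[of "a # u" u] by auto

lemma word_dist_self [simp]: "word_dist u u = 0"
  using word_dist_append[of u "[]"] by simp

lemma word_dist_1D:
  assumes "word_dist u v = 1"
  obtains a where "u = a # v" | a where "v = a # u"
proof -
  have "common_suffix_length u v = length v \<and> length u = length v + 1 \<or>
    common_suffix_length u v = length u \<and> length v = length u + 1"
    using common_suffix_length_le[of u v] assms unfolding word_dist_def by arith
  then show thesis
  proof
    assume *: "common_suffix_length u v = length v \<and> length u = length v + 1"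
    then obtain w where "u = w @ v"
      using common_suffix_length_eq_length[of v u] by (metis common_suffix_length_sym)
    then show thesis using that(1) * by (auto simp: length_Suc_conv)
  next
    assume *: "common_suffix_length u v = length u \<and> length v = length u + 1"
    then obtain w where "v = w @ u"
      using common_suffix_length_eq_length[of u v] by metis
    then show thesis using that(2) * by (auto simp: length_Suc_conv)
  qed
qed

theorem tree_metric_suffix_closed:
  assumes suffix_closed: "\<And>a u. a # u \<in> V \<Longrightarrow> u \<in> V"
  shows "tree_metric V word_dist"
proof
  fix x y z w :: "'a list"
  show "word_dist x y = word_dist y x" by (rule word_dist_sym)
  show "word_dist x y = 0 \<longleftrightarrow> x = y"
  proof
    assume "word_dist x y = 0"
    then have l: "common_suffix_length x y = length x" "length x = length y"
      using common_suffix_length_le[of x y] unfolding word_dist_def by linarith+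
    then obtain t where t: "y = t @ x" using common_suffix_length_eq_length by blast
    have "t = []" using l(2) unfolding t by simp
    then show "x = y" using t by simp
  qed simp
  show "even (word_dist x y + word_dist y z + word_dist x z)"
    unfolding word_dist_def by presburger
  let ?c = "\<lambda>u v. int (common_suffix_length u v)"
  have um: "min (?c p q) (?c q r) \<le> ?c p r" for p q r :: "'a list"
    using common_suffix_length_ultrametric[of p q r] by linarith
  show "word_dist x y + word_dist z w
      \<le> max (word_dist x z + word_dist y w) (word_dist x w + word_dist y z)"
    using um[of x z y] um[of x w y] um[of z x w] um[of z y w] common_suffix_length_sym[of z y]
      common_suffix_length_sym[of w y] common_suffix_length_sym[of z x]
    unfolding word_dist_def min_def max_def by (simp split: if_splits; linarith)
next
  fix x y assume V: "x \<in> V" "y \<in> V" "x \<noteq> y"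
  show "\<exists>p\<in>V. word_dist x p = 1 \<and> word_dist p y = word_dist x y - 1"
  proof (cases "common_suffix_length x y = length x")
    case True
    then obtain w where w: "y = w @ x" using common_suffix_length_eq_length by blast
    then obtain w' a where w': "w = w' @ [a]" using V(3) by (cases w rule: rev_cases) auto
    have "v @ u \<in> V \<Longrightarrow> u \<in> V" for v u by (induction v) (auto dest: suffix_closed)
    from this[of w' "a # x"] have "a # x \<in> V" using V w w' by simp
    moreover have "word_dist (a # x) y = word_dist x y - 1"
      using word_dist_append[of "a # x" w'] word_dist_append[of x "w' @ [a]"] w w' by simp
    ultimately show ?thesis by (auto intro!: bexI[of _ "a # x"])
  next
    case False
    then have lt: "common_suffix_length x y < length x"
      using common_suffix_length_le[of x y] by simp
    then obtain a t where x: "x = a # t" by (cases x) auto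
    then have "word_dist t y = word_dist x y - 1"
      using common_suffix_length_tl[OF lt] by (simp add: word_dist_def)
    then show ?thesis using V x suffix_closed by (auto intro!: bexI[of _ t])
  qed
qed

section \<open>Normal forms in HNN-extensions\<close>

text \<open>
  The associated subgroups and the isomorphism between them in both directions are indexed by the
  sign of the stable letter: \<open>a t\<^sup>b = t\<^sup>b (\<psi> b a)\<close> for \<open>a \<in> S b\<close>. With \<open>S True = A\<close>, \<open>S False = B\<close>,
  \<open>\<psi> True = \<phi>\<close> and \<open>\<psi> False\<close> the inverse of \<open>\<phi>\<close>, each argument covers both signs.
\<close>
locale hnn_data = group G for G :: "('a, 'm) monoid_scheme" (structure) +
  fixes S :: "bool \<Rightarrow> 'a set" and \<psi> :: "bool \<Rightarrow> 'a \<Rightarrow> 'a"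
  assumes subgroup_S: "subgroup (S b) G"
    and psi_closed [simp]: "a \<in> S b \<Longrightarrow> \<psi> b a \<in> S (\<not> b)"
    and psi_mult: "a \<in> S b \<Longrightarrow> a' \<in> S b \<Longrightarrow> \<psi> b (a \<otimes> a') = \<psi> b a \<otimes> \<psi> b a'"
    and psi_psi: "a \<in> S b \<Longrightarrow> \<psi> (\<not> b) (\<psi> b a) = a"
begin

lemma S_carrier [simp]: "a \<in> S b \<Longrightarrow> a \<in> carrier G"
  using subgroup.mem_carrier[OF subgroup_S] .

lemma S_closed [simp]: "\<one> \<in> S b" "a \<in> S b \<Longrightarrow> a' \<in> S b \<Longrightarrow> a \<otimes> a' \<in> S b"
    "a \<in> S b \<Longrightarrow> inv a \<in> S b"
  using subgroup.one_closed[OF subgroup_S] subgroup.m_closed[OF subgroup_S]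
    subgroup.m_inv_closed[OF subgroup_S] by auto

lemma psi_carrier [simp]: "a \<in> S b \<Longrightarrow> \<psi> b a \<in> carrier G"
  using psi_closed S_carrier by blast

lemma mult_in_S_iff:
  assumes "g \<in> carrier G" "s \<in> S b"
  shows "g \<otimes> s \<in> S b \<longleftrightarrow> g \<in> S b"
proof
  assume "g \<otimes> s \<in> S b"
  then have "g \<otimes> s \<otimes> inv s \<in> S b" using assms by auto
  then show "g \<in> S b" using assms by (simp add: m_assoc)
qed (use assms in simp)

text \<open>
  The representative of the coset \<open>g (S b)\<close>. It is \<open>\<one>\<close> for \<open>S b\<close> itself, so that an element
  of \<open>S b\<close> is moved across \<open>t\<^sup>b\<close> without leaving anything behind.
\<close>
definition rep :: "bool \<Rightarrow> 'a \<Rightarrow> 'a" where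
  "rep b g = (if g \<in> S b then \<one> else SOME x. x \<in> carrier G \<and> inv x \<otimes> g \<in> S b)"

definition tail :: "bool \<Rightarrow> 'a \<Rightarrow> 'a" where
  "tail b g = inv (rep b g) \<otimes> g"

lemma rep_tail:
  assumes "g \<in> carrier G"
  shows rep_closed [simp]: "rep b g \<in> carrier G" and tail_in [simp]: "tail b g \<in> S b"
    and rep_mult_tail: "rep b g \<otimes> tail b g = g"
proof -
  have "rep b g \<in> carrier G \<and> tail b g \<in> S b"
  proof (cases "g \<in> S b")
    case True
    then show ?thesis by (simp add: rep_def tail_def)
  next
    case False
    have "\<exists>x. x \<in> carrier G \<and> inv x \<otimes> g \<in> S b" using assms by (auto intro!: exI[of _ g])
    from someI_ex[OF this] show ?thesis using False by (simp add: rep_def tail_def)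
  qed
  then show *: "rep b g \<in> carrier G" "tail b g \<in> S b" by auto
  show "rep b g \<otimes> tail b g = g" using * assms by (simp add: tail_def m_assoc[symmetric])
qed

lemma rep_mult_S [simp]:
  assumes "g \<in> carrier G" "s \<in> S b"
  shows "rep b (g \<otimes> s) = rep b g"
proof -
  have "inv x \<otimes> (g \<otimes> s) \<in> S b \<longleftrightarrow> inv x \<otimes> g \<in> S b" if "x \<in> carrier G" for x
    using mult_in_S_iff[of "inv x \<otimes> g" s b] assms that by (simp add: m_assoc)
  then have "(\<lambda>x. x \<in> carrier G \<and> inv x \<otimes> (g \<otimes> s) \<in> S b) =
      (\<lambda>x. x \<in> carrier G \<and> inv x \<otimes> g \<in> S b)"
    by auto
  then show ?thesis using mult_in_S_iff[OF assms] by (simp add: rep_def)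
qed

lemma tail_mult_S: "g \<in> carrier G \<Longrightarrow> s \<in> S b \<Longrightarrow> tail b (g \<otimes> s) = tail b g \<otimes> s"
  by (simp add: tail_def m_assoc)

lemma rep_eq_oneD: "g \<in> carrier G \<Longrightarrow> rep b g = \<one> \<Longrightarrow> g \<in> S b"
  using tail_in[of g b] by (simp add: tail_def)

lemma rep_in_S: "s \<in> S b \<Longrightarrow> rep b s = \<one>"
  by (simp add: rep_def)

lemma rep_rep [simp]: "g \<in> carrier G \<Longrightarrow> rep b (rep b g) = rep b g"
  using rep_mult_S[of "rep b g" "tail b g" b] by (simp add: rep_mult_tail)

lemma rep_eqD:
  assumes "g \<in> carrier G" "h \<in> carrier G" "rep b g = rep b h"
  shows "inv g \<otimes> h \<in> S b"
proof -
  have "inv g \<otimes> h = inv (rep b h \<otimes> tail b g) \<otimes> (rep b h \<otimes> tail b h)"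
    using rep_mult_tail[OF assms(1), of b] rep_mult_tail[OF assms(2), of b] assms(3) by simp
  also have "\<dots> = inv (tail b g) \<otimes> (inv (rep b h) \<otimes> (rep b h \<otimes> tail b h))"
    using assms S_carrier[OF tail_in] by (simp add: inv_mult_group m_assoc)
  also have "inv (rep b h) \<otimes> (rep b h \<otimes> tail b h) = tail b h"
    using assms S_carrier[OF tail_in] by (simp flip: m_assoc)
  finally show ?thesis using assms by simp
qed

text \<open>
  An entry \<open>(r, b)\<close> is the syllable \<open>r t\<^sup>b\<close>, and the head of the list is the last syllable of the
  product. By the condition on \<open>r = \<one>\<close>, no \<open>t\<^sup>b t\<^sup>-\<^sup>b\<close> occurs.
\<close>
fun reduced :: "('a \<times> bool) list \<Rightarrow> bool" where
  "reduced [] \<longleftrightarrow> True"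
| "reduced ((r, b) # w) \<longleftrightarrow>
     r \<in> carrier G \<and> rep b r = r \<and> (r = \<one> \<longrightarrow> w = [] \<or> snd (hd w) = b) \<and> reduced w"

text \<open>
  The pair \<open>(w, k)\<close> is the product of the syllables of \<open>w\<close>, followed by \<open>k\<close>.
\<close>
definition normal_forms :: "(('a \<times> bool) list \<times> 'a) set" where
  "normal_forms = {w. reduced w} \<times> carrier G"

fun mult_base :: "'a \<Rightarrow> ('a \<times> bool) list \<times> 'a \<Rightarrow> ('a \<times> bool) list \<times> 'a" where
  "mult_base g (w, k) = (w, k \<otimes> g)"

text \<open>
  Right multiplication of \<open>w k\<close> by \<open>t\<^sup>b\<close>. If \<open>k \<in> S b\<close>, it can be moved across \<open>t\<^sup>b\<close>, which then cancels
  against a final \<open>t\<^sup>-\<^sup>b\<close> of \<open>w\<close>. Otherwise only the factor \<open>tail b k\<close> of \<open>k\<close> is moved across, and \<open>rep b k\<close> and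
  \<open>t\<^sup>b\<close> form a new syllable.
\<close>
fun mult_stable :: "bool \<Rightarrow> ('a \<times> bool) list \<times> 'a \<Rightarrow> ('a \<times> bool) list \<times> 'a" where
  "mult_stable b (w, k) =
     (if k \<in> S b \<and> w \<noteq> [] \<and> snd (hd w) = (\<not> b) then (tl w, fst (hd w) \<otimes> \<psi> b k)
      else ((rep b k, b) # w, \<psi> b (tail b k)))"

fun mult_letter :: "'a hnn_gen \<times> bool \<Rightarrow> ('a \<times> bool) list \<times> 'a \<Rightarrow> ('a \<times> bool) list \<times> 'a" where
  "mult_letter (Base g, b) s = mult_base (if b then g else inv g) s"
| "mult_letter (Stable, b) s = mult_stable b s"

lemma mult_base_normal [simp]:
  "s \<in> normal_forms \<Longrightarrow> g \<in> carrier G \<Longrightarrow> mult_base g s \<in> normal_forms"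
  by (cases s) (simp add: normal_forms_def)

lemma mult_stable_cases:
  assumes "s \<in> normal_forms"
  obtains (cancel) w k r where "s = ((r, \<not> b) # w, k)" "k \<in> S b" "reduced ((r, \<not> b) # w)"
      "mult_stable b s = (w, r \<otimes> \<psi> b k)"
  | (append) w k where "s = (w, k)" "reduced w" "k \<in> carrier G" "reduced ((rep b k, b) # w)"
      "mult_stable b s = ((rep b k, b) # w, \<psi> b (tail b k))"
proof -
  obtain w k where s: "s = (w, k)" "reduced w" "k \<in> carrier G"
    using assms by (auto simp: normal_forms_def)
  show thesis
  proof (cases "k \<in> S b \<and> w \<noteq> [] \<and> snd (hd w) = (\<not> b)")
    case True
    then obtain r w' where "w = (r, \<not> b) # w'" by (cases w) auto
    then show thesis using cancel[of r w' k] True s by auto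
  next
    case False
    then have "rep b k = \<one> \<longrightarrow> w = [] \<or> snd (hd w) = b" using rep_eq_oneD[of k b] s by auto
    then show thesis using append[of w k] False s by auto
  qed
qed

lemma mult_stable_normal [simp]:
  assumes "s \<in> normal_forms"
  shows "mult_stable b s \<in> normal_forms"
  using assms by (cases rule: mult_stable_cases[of s b]) (auto simp: normal_forms_def)

lemma mult_stable_append:
  assumes "reduced ((r, b) # w)"
  shows "mult_stable b (w, r) = ((r, b) # w, \<psi> b \<one>)"
  using assms rep_in_S[of r b] by (auto simp: tail_def)

text \<open>
  A cancellation is undone by appending, since the syllable that is uncovered does not cancel in a reduced
  word; and an appended syllable is removed by the opposite letter.
\<close>
lemma mult_stable_inverse:
  assumes "s \<in> normal_forms"
  shows "mult_stable (\<not> b) (mult_stable b s) = s"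
  using assms
proof (cases rule: mult_stable_cases[of s b])
  case (cancel w k r)
  have r: "r \<in> carrier G" "rep (\<not> b) r = r" using cancel by auto
  have "\<not> (r \<otimes> \<psi> b k \<in> S (\<not> b) \<and> w \<noteq> [] \<and> snd (hd w) = b)"
    using cancel r mult_in_S_iff[of r "\<psi> b k" "\<not> b"] rep_in_S[of r "\<not> b"] by auto
  moreover have "rep (\<not> b) (r \<otimes> \<psi> b k) = r" "tail (\<not> b) (r \<otimes> \<psi> b k) = \<psi> b k"
    using r cancel by (auto simp: tail_def m_assoc[symmetric])
  ultimately show ?thesis using cancel psi_psi by auto
next
  case (append w k)
  then show ?thesis using psi_psi[of "tail b k" b] by (simp add: rep_mult_tail)
qed

text \<open>
  This is the relation \<open>a t\<^sup>b = t\<^sup>b (\<psi> b a)\<close>, in its action on normal forms.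
\<close>
lemma mult_stable_mult_base:
  assumes "s \<in> normal_forms" "a \<in> S b"
  shows "mult_stable b (mult_base a s) = mult_base (\<psi> b a) (mult_stable b s)"
proof -
  obtain w k where s: "s = (w, k)" "reduced w" "k \<in> carrier G"
    using assms by (auto simp: normal_forms_def)
  have "fst (hd w) \<in> carrier G" if "w \<noteq> []"
    using s(2) that by (cases w) auto
  then show ?thesis
    using s assms mult_in_S_iff[of k a b] by (auto simp: psi_mult tail_mult_S m_assoc)
qed

lemma mult_letter_normal:
  "s \<in> normal_forms \<Longrightarrow> fst x \<in> hnn_generators G \<Longrightarrow> mult_letter x s \<in> normal_forms"
  by (cases x rule: prod.exhaust, cases "fst x") (auto simp: hnn_generators_def)

lemma mult_word_normal:
  "s \<in> normal_forms \<Longrightarrow> u \<in> gwords (hnn_generators G) \<Longrightarrow> fold mult_letter u s \<in> normal_forms"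
  by (induction u arbitrary: s) (simp_all add: mult_letter_normal)

lemma mult_letter_cancel:
  assumes "s \<in> normal_forms" "x \<in> hnn_generators G"
  shows "mult_letter (x, \<not> b) (mult_letter (x, b) s) = s"
proof (cases x)
  case (Base g)
  then have "g \<in> carrier G" using assms by (auto simp: hnn_generators_def)
  then show ?thesis using Base assms by (cases s) (auto simp: m_assoc normal_forms_def)
next
  case Stable
  then show ?thesis using mult_stable_inverse assms by simp
qed

text \<open>
  As the relations of the HNN-extension hold for the action on normal forms, words for the
  same element act equally. Applied to the empty normal form, this makes normal forms unique.
\<close>
lemma mult_word_cong:
  assumes "pres_eq (hnn_generators G) (hnn_relations G (S True) (\<psi> True)) u v" "s \<in> normal_forms"
  shows "fold mult_letter u s = fold mult_letter v s"
  using assms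
proof (induction arbitrary: s rule: pres_eq.induct)
  case (cancel x u v b)
  then show ?case
    using mult_letter_cancel[of "fold mult_letter u s" x b] mult_word_normal[of s u] by simp
next
  case (relation l r u v)
  define s' where "s' = fold mult_letter u s"
  have s': "s' \<in> normal_forms" using relation mult_word_normal by (simp add: s'_def)
  have "fold mult_letter l s' = fold mult_letter r s'"
    using relation(1) unfolding hnn_relations_def
  proof (elim UnE CollectE exE conjE)
    fix g h assume "(l, r) = ([(Base g, True), (Base h, True)], [(Base (g \<otimes> h), True)])"
      "g \<in> carrier G" "h \<in> carrier G"
    then show ?thesis using s' by (cases s') (auto simp: normal_forms_def m_assoc)
  next
    fix a assume *: "(l, r) = ([(Stable, False), (Base a, True), (Stable, True)], [(Base (\<psi> True a), True)])"
      "a \<in> S True"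
    have "mult_stable True (mult_base a (mult_stable False s')) = mult_base (\<psi> True a) s'"
      using mult_stable_mult_base[of "mult_stable False s'" a True] s' *(2)
        mult_stable_inverse[of s' False] by simp
    then show ?thesis using * by simp
  qed
  then show ?case by (simp add: s'_def)
qed auto

definition H :: "'a hnn_gen gword set monoid" where
  "H = hnn_extension G (S True) (\<psi> True)"

definition word_class :: "'a hnn_gen gword \<Rightarrow> 'a hnn_gen gword set" where
  "word_class = pres_class (hnn_generators G) (hnn_relations G (S True) (\<psi> True))"

definition base :: "'a \<Rightarrow> 'a hnn_gen gword set" where
  "base g = word_class [(Base g, True)]"

definition stable :: "bool \<Rightarrow> 'a hnn_gen gword set" where
  "stable b = word_class [(Stable, b)]"

sublocale H: group H
  unfolding H_def hnn_extension_def by (rule presented_group_is_group)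

lemma H_one: "\<one>\<^bsub>H\<^esub> = word_class []"
  and H_carrier: "carrier H = word_class ` gwords (hnn_generators G)"
  and H_mult: "u \<in> gwords (hnn_generators G) \<Longrightarrow> v \<in> gwords (hnn_generators G) \<Longrightarrow>
    word_class u \<otimes>\<^bsub>H\<^esub> word_class v = word_class (u @ v)"
  by (simp_all add: H_def word_class_def hnn_extension_def presented_group_simps pres_class_mult)

lemma letters [simp]:
  "Stable \<in> hnn_generators G" "Base g \<in> hnn_generators G \<longleftrightarrow> g \<in> carrier G"
  by (auto simp: hnn_generators_def)

lemma base_closed [simp]: "g \<in> carrier G \<Longrightarrow> base g \<in> carrier H"
  and stable_closed [simp]: "stable b \<in> carrier H"
  by (auto simp: base_def stable_def H_carrier)

lemma base_mult:
  assumes "g \<in> carrier G" "h \<in> carrier G"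
  shows "base (g \<otimes> h) = base g \<otimes>\<^bsub>H\<^esub> base h"
proof -
  have "([(Base g, True), (Base h, True)], [(Base (g \<otimes> h), True)])
      \<in> hnn_relations G (S True) (\<psi> True)"
    unfolding hnn_relations_def using assms by blast
  from pres_eq.relation[OF this, of "hnn_generators G" "[]" "[]"] show ?thesis
    using assms by (simp add: base_def H_mult) (simp add: word_class_def pres_class_eqI)
qed

sublocale base: group_hom G H base
  by unfold_locales (auto simp: hom_def base_mult)

lemma stable_stable:
  shows "stable b \<otimes>\<^bsub>H\<^esub> stable (\<not> b) = \<one>\<^bsub>H\<^esub>"
  using pres_eq.cancel[of Stable "hnn_generators G" "[]" "[]" _ b]
  by (simp add: stable_def H_mult H_one) (simp add: word_class_def pres_class_eqI)

lemma base_stable: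
  assumes a: "a \<in> S b"
  shows "base a \<otimes>\<^bsub>H\<^esub> stable b = stable b \<otimes>\<^bsub>H\<^esub> base (\<psi> b a)"
proof -
  have conj: "stable False \<otimes>\<^bsub>H\<^esub> (base a' \<otimes>\<^bsub>H\<^esub> stable True) = base (\<psi> True a')" if "a' \<in> S True" for a'
  proof -
    have "([(Stable, False), (Base a', True), (Stable, True)], [(Base (\<psi> True a'), True)])
        \<in> hnn_relations G (S True) (\<psi> True)"
      unfolding hnn_relations_def using that by blast
    from pres_eq.relation[OF this, of "hnn_generators G" "[]" "[]"] show ?thesis
      using that by (simp add: base_def stable_def H_mult) (simp add: word_class_def pres_class_eqI)
  qed
  show ?thesis
  proof (cases b)
    case True
    have "stable True \<otimes>\<^bsub>H\<^esub> base (\<psi> True a) =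
        (stable True \<otimes>\<^bsub>H\<^esub> stable False) \<otimes>\<^bsub>H\<^esub> (base a \<otimes>\<^bsub>H\<^esub> stable True)"
      using a True conj[of a] by (simp add: H.m_assoc)
    then show ?thesis using stable_stable[of True] a True by simp
  next
    case False
    let ?a = "\<psi> False a"
    have "?a \<in> S True" "\<psi> True ?a = a" using a False psi_closed[of a False] psi_psi[of a False] by auto
    then have "base a \<otimes>\<^bsub>H\<^esub> stable False =
        stable False \<otimes>\<^bsub>H\<^esub> (base ?a \<otimes>\<^bsub>H\<^esub> (stable True \<otimes>\<^bsub>H\<^esub> stable False))"
      using conj[of ?a] by (simp flip: H.m_assoc)
    then show ?thesis using stable_stable[of True] \<open>?a \<in> S True\<close> False by simp
  qed
qed

lemma H_induct [consumes 1, case_names one base stable]: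
  assumes "h \<in> carrier H" and one: "P \<one>\<^bsub>H\<^esub>"
    and base: "\<And>h g. h \<in> carrier H \<Longrightarrow> P h \<Longrightarrow> g \<in> carrier G \<Longrightarrow> P (h \<otimes>\<^bsub>H\<^esub> base g)"
    and stable: "\<And>h b. h \<in> carrier H \<Longrightarrow> P h \<Longrightarrow> P (h \<otimes>\<^bsub>H\<^esub> stable b)"
  shows "P h"
proof -
  have "u \<in> gwords (hnn_generators G) \<Longrightarrow> P (word_class u)" for u
  proof (induction u rule: rev_induct)
    case Nil
    then show ?case using one by (simp add: H_one)
  next
    case (snoc x u)
    then have u: "u \<in> gwords (hnn_generators G)" "fst x \<in> hnn_generators G"
      "word_class u \<in> carrier H" "P (word_class u)"
      by (auto simp: H_carrier)
    have ux: "word_class (u @ [x]) = word_class u \<otimes>\<^bsub>H\<^esub> word_class [x]"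
      using u by (simp add: H_mult)
    show ?case
    proof (cases "fst x")
      case Stable
      then have "word_class [x] = stable (snd x)" by (simp add: stable_def flip: Stable)
      then show ?thesis using ux stable u by simp
    next
      case (Base g)
      then have g: "g \<in> carrier G" using u by auto
      \<comment> \<open>Words may also contain formal inverses of elements of \<open>G\<close>.\<close>
      have "word_class [(Base g, False)] = inv\<^bsub>H\<^esub> base g"
      proof (rule H.inv_equality[symmetric])
        show "word_class [(Base g, False)] \<otimes>\<^bsub>H\<^esub> base g = \<one>\<^bsub>H\<^esub>"
          using pres_eq.cancel[of "Base g" "hnn_generators G" "[]" "[]" _ False] g
          by (simp add: base_def H_mult H_one) (simp add: word_class_def pres_class_eqI)
      qed (use g in \<open>auto simp: H_carrier base_def\<close>)
      then have "word_class [x] = base (if snd x then g else inv g)"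
        using g Base by (cases x) (auto simp: base_def[symmetric])
      then show ?thesis using ux base u g by simp
    qed
  qed
  then show ?thesis using assms(1) by (auto simp: H_carrier)
qed

text \<open>
  By \<open>mult_word_cong\<close> the value does not depend on the word chosen to represent \<open>h\<close>.
\<close>
definition nf :: "'a hnn_gen gword set \<Rightarrow> ('a \<times> bool) list \<times> 'a" where
  "nf h = fold mult_letter (SOME u. u \<in> h) ([], \<one>)"

lemma empty_normal [simp]: "([], \<one>) \<in> normal_forms"
  by (simp add: normal_forms_def)

lemma nf_word_class:
  assumes "u \<in> gwords (hnn_generators G)"
  shows "nf (word_class u) = fold mult_letter u ([], \<one>)"
proof -
  have "u \<in> word_class u" using assms by (simp add: word_class_def pres_class_def pres_eq.refl)
  then have "(SOME v. v \<in> word_class u) \<in> word_class u" by (rule someI)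
  then show ?thesis
    using mult_word_cong[of u _ "([], \<one>)"] by (simp add: nf_def word_class_def pres_class_def)
qed

lemma nf_one: "nf \<one>\<^bsub>H\<^esub> = ([], \<one>)"
  by (simp add: H_one nf_word_class)

lemma nf_base: "h \<in> carrier H \<Longrightarrow> g \<in> carrier G \<Longrightarrow> nf (h \<otimes>\<^bsub>H\<^esub> base g) = mult_base g (nf h)"
  by (auto simp: H_carrier base_def H_mult nf_word_class)

lemma nf_stable: "h \<in> carrier H \<Longrightarrow> nf (h \<otimes>\<^bsub>H\<^esub> stable b) = mult_stable b (nf h)"
  by (auto simp: H_carrier stable_def H_mult nf_word_class)

lemma nf_normal: "h \<in> carrier H \<Longrightarrow> nf h \<in> normal_forms"
  by (auto simp: H_carrier nf_word_class mult_word_normal)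

text \<open>
  The vertex \<open>h G\<close> of the Bass--Serre tree, encoded by the reduced word that leads to it from the vertex \<open>G\<close>.
\<close>
definition path :: "'a hnn_gen gword set \<Rightarrow> ('a \<times> bool) list" where
  "path h = fst (nf h)"

fun vert :: "('a \<times> bool) list \<Rightarrow> 'a hnn_gen gword set" where
  "vert [] = \<one>\<^bsub>H\<^esub>"
| "vert ((r, b) # w) = vert w \<otimes>\<^bsub>H\<^esub> base r \<otimes>\<^bsub>H\<^esub> stable b"

lemma vert_closed [simp]: "reduced w \<Longrightarrow> vert w \<in> carrier H"
  by (induction w rule: vert.induct) auto

lemma reduced_path [simp]: "h \<in> carrier H \<Longrightarrow> reduced (path h)"
  using nf_normal[of h] by (auto simp: path_def normal_forms_def)

lemma path_base [simp]: "h \<in> carrier H \<Longrightarrow> g \<in> carrier G \<Longrightarrow> path (h \<otimes>\<^bsub>H\<^esub> base g) = path h"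
  by (cases "nf h") (simp add: path_def nf_base)

text \<open>
  The normal form of \<open>h\<close> multiplies out to \<open>h\<close>, by induction on a word for \<open>h\<close>: a stable letter changes
  the normal form as prescribed by the relation \<open>base_stable\<close>.
\<close>
lemma normal_form_eq:
  assumes "h \<in> carrier H"
  shows "vert (fst (nf h)) \<otimes>\<^bsub>H\<^esub> base (snd (nf h)) = h"
  using assms
proof (induction rule: H_induct)
  case one
  then show ?case by (simp add: nf_one)
next
  case (base h g)
  then show ?case
    using nf_normal[of h] by (cases "nf h") (simp add: nf_base normal_forms_def flip: H.m_assoc)
next
  case (stable h b)
  from nf_normal[OF stable(1)] show ?case
  proof (cases rule: mult_stable_cases[of "nf h" b])
    case (cancel w k r)
    have h: "h = vert w \<otimes>\<^bsub>H\<^esub> base r \<otimes>\<^bsub>H\<^esub> stable (\<not> b) \<otimes>\<^bsub>H\<^esub> base k"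
      using stable(2) cancel by simp
    have "h \<otimes>\<^bsub>H\<^esub> stable b =
        vert w \<otimes>\<^bsub>H\<^esub> base r \<otimes>\<^bsub>H\<^esub> (stable (\<not> b) \<otimes>\<^bsub>H\<^esub> (base k \<otimes>\<^bsub>H\<^esub> stable b))"
      using cancel h by (simp add: H.m_assoc)
    also have "\<dots> = vert w \<otimes>\<^bsub>H\<^esub> base r \<otimes>\<^bsub>H\<^esub> (stable (\<not> b) \<otimes>\<^bsub>H\<^esub> stable b \<otimes>\<^bsub>H\<^esub> base (\<psi> b k))"
      using cancel by (simp add: base_stable H.m_assoc)
    also have "\<dots> = vert w \<otimes>\<^bsub>H\<^esub> base (r \<otimes> \<psi> b k)"
      using stable_stable[of "\<not> b"] cancel by (simp add: H.m_assoc)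
    finally have "vert w \<otimes>\<^bsub>H\<^esub> base (r \<otimes> \<psi> b k) = h \<otimes>\<^bsub>H\<^esub> stable b" ..
    moreover have "nf (h \<otimes>\<^bsub>H\<^esub> stable b) = (w, r \<otimes> \<psi> b k)"
      using nf_stable[OF stable(1)] cancel by simp
    ultimately show ?thesis by simp
  next
    case (append w k)
    have h: "h = vert w \<otimes>\<^bsub>H\<^esub> base (rep b k \<otimes> tail b k)"
      using stable(2) append by (simp add: rep_mult_tail)
    have "h \<otimes>\<^bsub>H\<^esub> stable b =
        vert w \<otimes>\<^bsub>H\<^esub> base (rep b k) \<otimes>\<^bsub>H\<^esub> (base (tail b k) \<otimes>\<^bsub>H\<^esub> stable b)"
      using append h S_carrier[OF tail_in[of k b]] by (simp add: H.m_assoc)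
    then have "vert ((rep b k, b) # w) \<otimes>\<^bsub>H\<^esub> base (\<psi> b (tail b k)) = h \<otimes>\<^bsub>H\<^esub> stable b"
      using append S_carrier[OF tail_in[of k b]] by (simp add: base_stable H.m_assoc)
    moreover have "nf (h \<otimes>\<^bsub>H\<^esub> stable b) = ((rep b k, b) # w, \<psi> b (tail b k))"
      using nf_stable[OF stable(1)] append by simp
    ultimately show ?thesis by simp
  qed
qed

lemma path_decomposition:
  assumes "h \<in> carrier H"
  obtains k where "k \<in> carrier G" "h = vert (path h) \<otimes>\<^bsub>H\<^esub> base k"
  using that[of "snd (nf h)"] normal_form_eq[OF assms] nf_normal[OF assms]
  by (auto simp: path_def normal_forms_def)

lemma nf_vert: "reduced w \<Longrightarrow> nf (vert w) = (w, \<one>)"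
proof (induction w rule: vert.induct)
  case 1
  then show ?case by (simp add: nf_one)
next
  case (2 r b w)
  have "\<psi> b \<one> = \<one>"
    using psi_mult[of "\<one>" b "\<one>"] l_cancel_one[of "\<psi> b \<one>" "\<psi> b \<one>"] by simp
  then show ?case
    using 2 mult_stable_append[of r b w] by (simp add: nf_stable nf_base del: mult_stable.simps)
qed

lemma path_vert [simp]: "reduced w \<Longrightarrow> path (vert w) = w"
  by (simp add: path_def nf_vert)

lemma base_inj:
  assumes "g \<in> carrier G" "h \<in> carrier G" "base g = base h"
  shows "g = h"
  using nf_base[of "\<one>\<^bsub>H\<^esub>" g] nf_base[of "\<one>\<^bsub>H\<^esub>" h] assms by (simp add: nf_one)

end

section \<open>The Bass--Serre tree of a separated HNN-extension\<close>

locale separated_hnn = hnn_data G S \<psi>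
  for G :: "('a, 'm) monoid_scheme" (structure) and S \<psi> +
  assumes malnormal_S: "malnormal (S b) G"
    and separated: "hnn_separated G (S True) (S False)"
begin

abbreviation V :: "('a \<times> bool) list set" where
  "V \<equiv> {w. reduced w}"

text \<open>
  Left multiplication on cosets, with the vertex \<open>w\<close> represented by the element \<open>vert w\<close>.
\<close>
definition act :: "'a hnn_gen gword set \<Rightarrow> ('a \<times> bool) list \<Rightarrow> ('a \<times> bool) list" where
  "act h w = path (h \<otimes>\<^bsub>H\<^esub> vert w)"

sublocale tree: tree_metric V word_dist
  by (rule tree_metric_suffix_closed) auto

lemma act_path:
  assumes "x \<in> carrier H" "y \<in> carrier H"
  shows "act x (path y) = path (x \<otimes>\<^bsub>H\<^esub> y)"
proof -
  obtain k where k: "k \<in> carrier G" "y = vert (path y) \<otimes>\<^bsub>H\<^esub> base k"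
    using path_decomposition assms(2) by blast
  have "path (x \<otimes>\<^bsub>H\<^esub> y) = path (x \<otimes>\<^bsub>H\<^esub> vert (path y) \<otimes>\<^bsub>H\<^esub> base k)"
    using k assms by (metis H.m_assoc base_closed reduced_path vert_closed)
  then show ?thesis using k(1) assms by (simp add: act_def)
qed

lemma act_reduced: "x \<in> carrier H \<Longrightarrow> reduced w \<Longrightarrow> reduced (act x w)"
  by (simp add: act_def)

lemma act_one: "reduced w \<Longrightarrow> act \<one>\<^bsub>H\<^esub> w = w"
  by (simp add: act_def)

lemma act_mult:
  "x \<in> carrier H \<Longrightarrow> y \<in> carrier H \<Longrightarrow> reduced w \<Longrightarrow> act (x \<otimes>\<^bsub>H\<^esub> y) w = act x (act y w)"
  using act_path[of x "y \<otimes>\<^bsub>H\<^esub> vert w"] by (simp add: act_def H.m_assoc)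

text \<open>
  Multiplication by \<open>t\<^sup>\<plusminus>\<close> adds or removes one syllable.
\<close>
lemma path_stable_adjacent:
  assumes "h \<in> carrier H"
  shows "word_dist (path h) (path (h \<otimes>\<^bsub>H\<^esub> stable b)) = 1"
proof -
  from nf_normal[OF assms] show ?thesis
    using assms by (cases rule: mult_stable_cases[of "nf h" b])
      (auto simp: path_def nf_stable simp del: mult_stable.simps)
qed

text \<open>
  The neighbours of \<open>hG\<close> are the cosets \<open>h r t\<^sup>\<plusminus> G\<close>. The parent of \<open>p\<close> is included with \<open>r = \<one>\<close> and the sign
  opposite to that of the last syllable of \<open>p\<close>. This description refers to multiplication on the right only, so it
  is respected by left multiplication.
\<close>
lemma adjacent_path_stable:
  assumes "reduced p" "reduced u" "word_dist p u = 1"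
  obtains r b where "r \<in> carrier G" "u = path (vert p \<otimes>\<^bsub>H\<^esub> base r \<otimes>\<^bsub>H\<^esub> stable b)"
  using assms(3)
proof (cases rule: word_dist_1D)
  case (1 a)
  obtain r b where a: "a = (r, b)" by (cases a)
  have r: "r \<in> carrier G" using 1 a assms by simp
  have "vert p \<otimes>\<^bsub>H\<^esub> base \<one> \<otimes>\<^bsub>H\<^esub> stable (\<not> b) = vert u \<otimes>\<^bsub>H\<^esub> base r"
    using 1 a r assms stable_stable[of b] by (simp add: H.m_assoc)
  then have "u = path (vert p \<otimes>\<^bsub>H\<^esub> base \<one> \<otimes>\<^bsub>H\<^esub> stable (\<not> b))"
    using r assms by simp
  then show thesis using that one_closed by blast
next
  case (2 a)
  obtain r b where a: "a = (r, b)" by (cases a)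
  have "r \<in> carrier G" using 2 a assms by simp
  moreover have "u = path (vert p \<otimes>\<^bsub>H\<^esub> base r \<otimes>\<^bsub>H\<^esub> stable b)"
    using path_vert[OF assms(2)] 2 a by simp
  ultimately show thesis using that by blast
qed

lemma act_edge:
  assumes x: "x \<in> carrier H" and "reduced p" "reduced u" "word_dist p u = 1"
  shows "word_dist (act x p) (act x u) = 1"
proof -
  obtain r b where r: "r \<in> carrier G" and u: "u = path (vert p \<otimes>\<^bsub>H\<^esub> base r \<otimes>\<^bsub>H\<^esub> stable b)"
    using adjacent_path_stable assms by blast
  have "act x u = path (x \<otimes>\<^bsub>H\<^esub> vert p \<otimes>\<^bsub>H\<^esub> base r \<otimes>\<^bsub>H\<^esub> stable b)"
    using r x assms(2) unfolding u by (simp add: act_path H.m_assoc)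
  moreover have "act x p = path (x \<otimes>\<^bsub>H\<^esub> vert p \<otimes>\<^bsub>H\<^esub> base r)"
    using r x assms(2) by (simp add: act_def)
  ultimately show ?thesis
    using path_stable_adjacent[of "x \<otimes>\<^bsub>H\<^esub> vert p \<otimes>\<^bsub>H\<^esub> base r" b] r x assms(2) by simp
qed

lemma act_isometry:
  assumes x: "x \<in> carrier H" and u: "reduced u" and v: "reduced v"
  shows "word_dist (act x u) (act x v) = word_dist u v"
proof (rule antisym)
  have *: "word_dist (act y p) (act y q) \<le> word_dist p q"
    if "y \<in> carrier H" "reduced p" "reduced q" for y p q
    using tree.edge_map_contracts[of "act y" p q] act_reduced act_edge that by simp
  show "word_dist (act x u) (act x v) \<le> word_dist u v" using * assms by blast
  have "act (inv\<^bsub>H\<^esub> x) (act x w) = w" if "reduced w" for w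
    using act_mult[of "inv\<^bsub>H\<^esub> x" x w] act_one x that by simp
  then show "word_dist u v \<le> word_dist (act x u) (act x v)"
    using *[of "inv\<^bsub>H\<^esub> x" "act x u" "act x v"] act_reduced x u v by simp
qed

definition sign :: "bool \<Rightarrow> int" where
  "sign b = (if b then 1 else -1)"

text \<open>
  The exponent sum of the stable letter.
\<close>
definition exponent :: "('a \<times> bool) list \<Rightarrow> int" where
  "exponent w = sum_list (map (sign \<circ> snd) w)"

lemma exponent_simps [simp]: "exponent [] = 0" "exponent ((r, b) # w) = sign b + exponent w"
  by (simp_all add: exponent_def)

lemma exponent_path_stable:
  assumes "h \<in> carrier H"
  shows "exponent (path (h \<otimes>\<^bsub>H\<^esub> stable b)) = exponent (path h) + sign b"
proof -
  from nf_normal[OF assms] show ?thesis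
    using assms by (cases rule: mult_stable_cases[of "nf h" b])
      (auto simp: path_def nf_stable sign_def simp del: mult_stable.simps)
qed

lemma exponent_path_mult:
  assumes "x \<in> carrier H" "y \<in> carrier H"
  shows "exponent (path (x \<otimes>\<^bsub>H\<^esub> y)) = exponent (path x) + exponent (path y)"
  using assms(2)
proof (induction rule: H_induct)
  case one
  then show ?case using assms(1) by (simp add: path_def nf_one)
next
  case (base h g)
  then show ?case using assms(1) by (simp flip: H.m_assoc)
next
  case (stable h b)
  then show ?case using assms(1) by (simp add: exponent_path_stable flip: H.m_assoc)
qed

lemma no_inversion:
  assumes x: "x \<in> carrier H" and v: "reduced v" and adj: "word_dist v (act x v) = 1"
  shows "act x (act x v) \<noteq> v"
proof
  assume inv: "act x (act x v) = v"
  have *: "exponent (act x w) = exponent (path x) + exponent w" if "reduced w" for w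
    using exponent_path_mult[of x "vert w"] x that by (simp add: act_def)
  have "exponent (act x v) \<noteq> exponent v"
    using adj
  proof (cases rule: word_dist_1D)
    case (1 a)
    then have "exponent v = sign (snd a) + exponent (act x v)"
      by (metis exponent_simps(2) prod.collapse)
    then show ?thesis by (simp add: sign_def split: if_splits)
  next
    case (2 a)
    then have "exponent (act x v) = sign (snd a) + exponent v"
      by (metis exponent_simps(2) prod.collapse)
    then show ?thesis by (simp add: sign_def split: if_splits)
  qed
  moreover have "2 * exponent (path x) = 0"
    using *[of v] *[of "act x v"] act_reduced[OF x v] inv v by simp
  ultimately show False using *[of v] v by simp
qed

lemma fixed_vertexE:
  assumes "x \<in> carrier H" "reduced p" "act x p = p"
  obtains k where "k \<in> carrier G" "x \<otimes>\<^bsub>H\<^esub> vert p = vert p \<otimes>\<^bsub>H\<^esub> base k"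
  using path_decomposition[of "x \<otimes>\<^bsub>H\<^esub> vert p"] assms unfolding act_def
  by (metis H.m_closed vert_closed)

text \<open>
  Separation is symmetric in the two associated subgroups.
\<close>
lemma separatedD:
  assumes "s \<in> S b" "s' \<in> S (\<not> b)" "g \<in> carrier G" "s \<otimes> g = g \<otimes> s'"
  shows "s = \<one>"
proof -
  have sep: "a = \<one>" if "a \<in> S True" "a' \<in> S False" "g \<in> carrier G" "a = inv g \<otimes> a' \<otimes> g" for a a' g
    using separated that unfolding hnn_separated_def l_coset_def r_coset_def by blast
  show ?thesis
  proof (cases b)
    case True
    have "s = inv (inv g) \<otimes> s' \<otimes> inv g"
      using assms S_carrier[OF assms(1)] S_carrier[OF assms(2)] by (simp add: inv_solve_right)
    then show ?thesis using sep[of s s' "inv g"] assms True by simp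
  next
    case False
    have "s' = inv g \<otimes> s \<otimes> g"
      using assms(3,4) S_carrier[OF assms(1)] S_carrier[OF assms(2)] by (simp add: m_assoc inv_solve_left)
    moreover from this have "s' = \<one>" using sep[of s' s g] assms False by simp
    ultimately show ?thesis
      using assms(3,4) S_carrier[OF assms(1)] r_cancel_one[of g s] by simp
  qed
qed

text \<open>
  After translation of \<open>p\<close> to the base vertex, the neighbours \<open>r t\<^sup>b G\<close> of sign \<open>b\<close> correspond to the cosets
  \<open>r (S b)\<close>. So \<open>k\<close> fixes such a neighbour only if it lies in the conjugate of \<open>S b\<close> by \<open>r\<close>.
\<close>
lemma fixed_neighbour:
  assumes x: "x \<in> carrier H" and p: "reduced p" and k: "k \<in> carrier G" and r: "r \<in> carrier G"
    and xp: "x \<otimes>\<^bsub>H\<^esub> vert p = vert p \<otimes>\<^bsub>H\<^esub> base k"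
    and u: "u = path (vert p \<otimes>\<^bsub>H\<^esub> base r \<otimes>\<^bsub>H\<^esub> stable b)" and fixed: "act x u = u"
  obtains s where "s \<in> S b" "k \<otimes> r = r \<otimes> s"
proof -
  have path1: "path (base g \<otimes>\<^bsub>H\<^esub> stable b) = [(rep b g, b)]" if "g \<in> carrier G" for g
    using nf_base[of "\<one>\<^bsub>H\<^esub>" g] nf_stable[of "base g" b] that by (simp add: path_def nf_one)
  have u': "u = act (vert p) [(rep b r, b)]"
    using path1[OF r] act_path[of "vert p" "base r \<otimes>\<^bsub>H\<^esub> stable b"] p r u by (simp add: H.m_assoc)
  have "x \<otimes>\<^bsub>H\<^esub> (vert p \<otimes>\<^bsub>H\<^esub> base r \<otimes>\<^bsub>H\<^esub> stable b) =
      vert p \<otimes>\<^bsub>H\<^esub> (base (k \<otimes> r) \<otimes>\<^bsub>H\<^esub> stable b)"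
    using xp x p r k by (simp flip: H.m_assoc)
  then have "u = path (vert p \<otimes>\<^bsub>H\<^esub> (base (k \<otimes> r) \<otimes>\<^bsub>H\<^esub> stable b))"
    using fixed act_path[OF x, of "vert p \<otimes>\<^bsub>H\<^esub> base r \<otimes>\<^bsub>H\<^esub> stable b"] u p r by simp
  then have "u = act (vert p) [(rep b (k \<otimes> r), b)]"
    using path1[of "k \<otimes> r"] act_path[of "vert p" "base (k \<otimes> r) \<otimes>\<^bsub>H\<^esub> stable b"] p r k by simp
  then have "word_dist (act (vert p) [(rep b r, b)]) (act (vert p) [(rep b (k \<otimes> r), b)]) = 0"
    using u' by simp
  then have "word_dist [(rep b r, b)] [(rep b (k \<otimes> r), b)] = 0"
    using act_isometry[of "vert p" "[(rep b r, b)]" "[(rep b (k \<otimes> r), b)]"] p r k by simp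
  then have "rep b r = rep b (k \<otimes> r)"
    using tree.dist_eq_0[of "[(rep b r, b)]" "[(rep b (k \<otimes> r), b)]"] r k by simp
  then have "inv r \<otimes> (k \<otimes> r) \<in> S b" using rep_eqD r k by simp
  moreover have "k \<otimes> r = r \<otimes> (inv r \<otimes> (k \<otimes> r))" using r k by (simp flip: m_assoc)
  ultimately show thesis using that by blast
qed

text \<open>
  With \<open>x\<close> acting at \<open>p\<close> as \<open>k \<in> G\<close>, two fixed neighbours place \<open>k\<close> in the conjugate of \<open>S b\<close> by \<open>r\<close> and in that of
  \<open>S b'\<close> by \<open>r'\<close>. For \<open>b = b'\<close>, malnormality gives \<open>r' \<in> r (S b)\<close>, and the neighbours coincide; for \<open>b \<noteq> b'\<close>,
  separation gives \<open>k = \<one>\<close>.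
\<close>
lemma no_two_fixed_neighbours:
  assumes x: "x \<in> carrier H" "x \<noteq> \<one>\<^bsub>H\<^esub>" and p: "reduced p" and u: "reduced u" and v: "reduced v"
    and adj: "word_dist p u = 1" "word_dist p v = 1"
    and fixed: "act x p = p" "act x u = u" "act x v = v"
  shows "u = v"
proof -
  obtain k where k: "k \<in> carrier G" "x \<otimes>\<^bsub>H\<^esub> vert p = vert p \<otimes>\<^bsub>H\<^esub> base k"
    using fixed_vertexE[OF x(1) p fixed(1)] .
  have k1: "k \<noteq> \<one>"
  proof
    assume "k = \<one>"
    then have "x \<otimes>\<^bsub>H\<^esub> vert p = \<one>\<^bsub>H\<^esub> \<otimes>\<^bsub>H\<^esub> vert p" using k(2) p by simp
    then show False using H.right_cancel[of "vert p" x "\<one>\<^bsub>H\<^esub>"] x p by simp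
  qed
  obtain r b where r: "r \<in> carrier G" "u = path (vert p \<otimes>\<^bsub>H\<^esub> base r \<otimes>\<^bsub>H\<^esub> stable b)"
    using adjacent_path_stable p u adj by blast
  obtain r' b' where r': "r' \<in> carrier G" "v = path (vert p \<otimes>\<^bsub>H\<^esub> base r' \<otimes>\<^bsub>H\<^esub> stable b')"
    using adjacent_path_stable p v adj by blast
  obtain s where s: "s \<in> S b" "k \<otimes> r = r \<otimes> s"
    using fixed_neighbour[OF x(1) p k(1) r(1) k(2) r(2) fixed(2)] .
  obtain s' where s': "s' \<in> S b'" "k \<otimes> r' = r' \<otimes> s'"
    using fixed_neighbour[OF x(1) p k(1) r'(1) k(2) r'(2) fixed(3)] .
  note c = k(1) r(1) r'(1) S_carrier[OF s(1)] S_carrier[OF s'(1)]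
  define g where "g = inv r \<otimes> r'"
  have g: "g \<in> carrier G" "r' = r \<otimes> g" using c by (auto simp: g_def simp flip: m_assoc)
  have "r \<otimes> (s \<otimes> g) = r \<otimes> (g \<otimes> s')"
    using s s' c g by (metis m_assoc)
  then have sg: "s \<otimes> g = g \<otimes> s'" using c g by simp
  have ne1: "t \<noteq> \<one>" if "k \<otimes> q = q \<otimes> t" "q \<in> carrier G" for q t
  proof
    assume "t = \<one>"
    then have "k \<otimes> q = \<one> \<otimes> q" using that by simp
    then show False using right_cancel[of q k "\<one>"] that(2) k(1) k1 by simp
  qed
  show ?thesis
  proof (cases "b' = b")
    case True
    have gS: "g \<in> S b"
      using malnormal_conjD[OF malnormal_S g(1) _ s(1) ne1[OF s'(2) r'(1)] is_group sg] s'(1) True by simp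
    \<comment> \<open>An element of \<open>S b\<close> moves across \<open>t\<^sup>b\<close> and into \<open>G\<close>, so the two cosets are equal.\<close>
    have "vert p \<otimes>\<^bsub>H\<^esub> base r' \<otimes>\<^bsub>H\<^esub> stable b =
        vert p \<otimes>\<^bsub>H\<^esub> base r \<otimes>\<^bsub>H\<^esub> stable b \<otimes>\<^bsub>H\<^esub> base (\<psi> b g)"
      using base_stable[OF gS] gS g c p by (simp add: H.m_assoc)
    then show ?thesis using r(2) r'(2) True p c gS by simp
  next
    case False
    then have "b' = (\<not> b)" by auto
    then show ?thesis using separatedD[OF s(1) _ g(1) sg] s'(1) ne1[OF s(2) r(1)] by simp
  qed
qed

sublocale tree: acylindrical_tree_action H V word_dist act
proof unfold_locales
  show "V \<noteq> {}" by (auto intro: exI[of _ "[]"])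
  show "word_dist v w \<le> 1" if x: "x \<in> carrier H" "x \<noteq> \<one>\<^bsub>H\<^esub>" and V: "v \<in> V" "w \<in> V"
    and fixed: "act x v = v" "act x w = w" for x v w
  proof (rule ccontr)
    assume far: "\<not> word_dist v w \<le> 1"
    then have "v \<noteq> w" by auto
    \<comment> \<open>The first two steps from \<open>v\<close> towards \<open>w\<close>, whose middle vertex has two fixed neighbours.\<close>
    then obtain p where p: "p \<in> V" "word_dist v p = 1" "word_dist p w = word_dist v w - 1"
      using tree.step_towards[of v w] V by blast
    then have "p \<noteq> w" using far by auto
    then obtain q where q: "q \<in> V" "word_dist p q = 1" "word_dist q w = word_dist p w - 1"
      using tree.step_towards[of p w] p V by blast
    have vq: "word_dist v q = 2"
      using tree.triangle[of v p q] tree.triangle[of v q w] p q V by simp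
    have "act x p = p" "act x q = q"
      using tree.isometry_fixes_between[of "act x" v w] act_reduced act_isometry x V fixed p q vq
      by simp_all
    moreover have "word_dist p v = 1" using p word_dist_sym[of p v] by simp
    ultimately have "v = q"
      using no_two_fixed_neighbours[OF x, of p v q] p(1) q(1,2) V fixed(1) by blast
    then show False using vq by simp
  qed
qed (use act_reduced act_one act_mult act_isometry no_inversion in auto)

text \<open>
  The stabilizer of \<open>v\<close> is the conjugate of \<open>G\<close> by \<open>vert v\<close>.
\<close>
lemma stabilizer_csa_star:
  assumes G: "csa_star_group G" and v: "reduced v"
  shows "csa_star_group (H\<lparr>carrier := {h \<in> carrier H. act h v = v}\<rparr>)"
proof (rule csa_star_group_iso[OF G])
  let ?K = "{h \<in> carrier H. act h v = v}"
  let ?f = "\<lambda>g. vert v \<otimes>\<^bsub>H\<^esub> base g \<otimes>\<^bsub>H\<^esub> inv\<^bsub>H\<^esub> vert v"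
  have "subgroup ?K H"
  proof (rule H.subgroupI)
    have "\<one>\<^bsub>H\<^esub> \<in> ?K" using act_one v by simp
    then show "?K \<noteq> {}" by blast
    show "inv\<^bsub>H\<^esub> h \<in> ?K" if "h \<in> ?K" for h
      using that act_mult[of "inv\<^bsub>H\<^esub> h" h v] act_one v by simp
    show "h \<otimes>\<^bsub>H\<^esub> h' \<in> ?K" if "h \<in> ?K" "h' \<in> ?K" for h h'
      using that act_mult[of h h' v] v by simp
  qed auto
  then show "group (H\<lparr>carrier := ?K\<rparr>)"
    by (rule subgroup.subgroup_is_group) (rule H.is_group)
  have f_mult: "?f (g \<otimes> h) = ?f g \<otimes>\<^bsub>H\<^esub> ?f h" if "g \<in> carrier G" "h \<in> carrier G" for g h
  proof -
    have "inv\<^bsub>H\<^esub> vert v \<otimes>\<^bsub>H\<^esub> (vert v \<otimes>\<^bsub>H\<^esub> y) = y" if "y \<in> carrier H" for y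
      using v that by (simp flip: H.m_assoc)
    then show ?thesis using v that by (simp add: H.m_assoc)
  qed
  have f_K: "?f g \<in> ?K" if "g \<in> carrier G" for g
    using v that by (simp add: act_def H.m_assoc)
  have f_inj: "inj_on ?f (carrier G)"
    using v base_inj by (auto simp: inj_on_def)
  have f_surj: "h \<in> ?f ` carrier G" if h: "h \<in> ?K" for h
  proof -
    obtain k where "k \<in> carrier G" "h \<otimes>\<^bsub>H\<^esub> vert v = vert v \<otimes>\<^bsub>H\<^esub> base k"
      using fixed_vertexE[of h v] h v by auto
    then have "h = ?f k" using h v H.inv_solve_right[of h "vert v \<otimes>\<^bsub>H\<^esub> base k" "vert v"] by simp
    then show ?thesis using \<open>k \<in> carrier G\<close> by blast
  qed
  show "?f \<in> iso G (H\<lparr>carrier := ?K\<rparr>)"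
    unfolding iso_def bij_betw_def hom_def using f_mult f_K f_inj f_surj by auto
qed

theorem csa_star_hnn:
  assumes "csa_star_group G"
  shows "csa_star_group (hnn_extension G (S True) (\<psi> True))"
  using tree.csa_star_group_if_stabilizers stabilizer_csa_star[OF assms] by (simp add: H_def)

end

theorem corollary1:
  fixes G :: "('a, 'm) monoid_scheme" and A B :: "'a set" and \<phi> :: "'a \<Rightarrow> 'a"
  assumes "csa_star_group G"
    and "malnormal A G"
    and "malnormal B G"
    and "\<phi> \<in> iso (G\<lparr>carrier := A\<rparr>) (G\<lparr>carrier := B\<rparr>)"
    and "hnn_separated G A B"
  shows "csa_star_group (hnn_extension G A \<phi>)"
proof -
  interpret csa_star_group G by fact
  let ?S = "\<lambda>b. if b then A else B"
  let ?\<psi> = "\<lambda>b. if b then \<phi> else inv_into A \<phi>"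
  have A: "subgroup A G" and B: "subgroup B G" using assms(2,3) by (auto simp: malnormal_def)
  have bij: "bij_betw \<phi> A B" and hom: "\<And>a a'. a \<in> A \<Longrightarrow> a' \<in> A \<Longrightarrow> \<phi> (a \<otimes>\<^bsub>G\<^esub> a') = \<phi> a \<otimes>\<^bsub>G\<^esub> \<phi> a'"
    using assms(4) by (auto simp: iso_def hom_def)
  have inv_hom: "inv_into A \<phi> (c \<otimes>\<^bsub>G\<^esub> c') = inv_into A \<phi> c \<otimes>\<^bsub>G\<^esub> inv_into A \<phi> c'"
    if c: "c \<in> B" "c' \<in> B" for c c'
  proof -
    obtain a a' where a: "a \<in> A" "c = \<phi> a" "a' \<in> A" "c' = \<phi> a'"
      using bij c by (auto simp: bij_betw_def)
    then have "c \<otimes>\<^bsub>G\<^esub> c' = \<phi> (a \<otimes>\<^bsub>G\<^esub> a')" "a \<otimes>\<^bsub>G\<^esub> a' \<in> A"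
      using hom subgroup.m_closed[OF A] by auto
    then show ?thesis using a bij by (simp add: bij_betw_inv_into_left)
  qed
  interpret separated_hnn G ?S ?\<psi>
  proof (intro separated_hnn.intro hnn_data.intro hnn_data_axioms.intro separated_hnn_axioms.intro
      is_group)
    fix b :: bool and a a'
    show "subgroup (?S b) G" using A B by simp
    show "?\<psi> b a \<in> ?S (\<not> b)" if "a \<in> ?S b"
      using that bij bij_betw_apply[OF bij] bij_betw_apply[OF bij_betw_inv_into[OF bij]]
      by (auto split: if_splits)
    show "?\<psi> b (a \<otimes>\<^bsub>G\<^esub> a') = ?\<psi> b a \<otimes>\<^bsub>G\<^esub> ?\<psi> b a'" if "a \<in> ?S b" "a' \<in> ?S b"
      using that hom inv_hom by (auto split: if_splits)
    show "?\<psi> (\<not> b) (?\<psi> b a) = a" if "a \<in> ?S b"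
      using that bij by (auto simp: bij_betw_inv_into_left bij_betw_inv_into_right split: if_splits)
    show "malnormal (?S b) G" using assms(2,3) by simp
    show "hnn_separated G (?S True) (?S False)" using assms(5) by simp
  qed
  show ?thesis using csa_star_hnn[OF assms(1)] by simp
qed

end
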